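(* Let $q$ be a prime power and $m\ge 1$. Let $H_{\mathrm{obj}}\in\mathbb{C}^{q^m\times q^m}$ be a diagonal matrix (in the basis $\{|\mathbf{x}\rangle\}_{\mathbf{x}\in\mathbb{F}_q^m}$) with entries in $[0,1]$, and let $|\mathcal{S}\rangle=\sum_{\mathbf{x}\in\mathbb{F}_q^m}P(\mathbf{x})|\mathbf{x}\rangle$ be a normalized state. Let $\widetilde P$ denote the Fourier transform of $P$ over $\mathbb{F}_q^m$. Let $C\subseteq\mathbb{F}_q^m$ be a linear code and $C^\perp$ its dual. Using any quantum algorithm for the quantum decoding problem $\mathrm{QDP}_{C^\perp,\widetilde P}$ succeeding with probability $1-\epsilon$ (where $\epsilon<1$), Regev's reduction produces, for each $\mathbf{v}\in\mathbb{F}_q^m$, a mixed state $\rho(\mathbf{v})$ with support only on the codewords of $C$, such that $$\mathbb{E}_{\mathbf{v}}\left[\mathrm{tr}\left[X_q^{\mathbf{v}}H_{\mathrm{obj}}X_q^{-\mathbf{v}}\rho(\mathbf{v})\right]\right]\ \ge\ \langle\mathcal{S}|H_{\mathrm{obj}}|\mathcal{S}\rangle-2\sqrt{\epsilon},$$ where the expectation is over uniformly random $\mathbf{v}\in\mathbb{F}_q^m$.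
   Context: Fourier conventions. Let $q=p^r$ with $p$ prime, $\omega_p=e^{2\pi i/p}$, and $\mathrm{tr}(a)=\sum_{i=0}^{r-1}a^{p^i}\in\mathbb{F}_p$ for $a\in\mathbb{F}_q$. For $a,b\in\mathbb{F}_q$ let $\chi_a(b)=\omega_p^{\mathrm{tr}(ab)}$, and for $\mathbf{a},\mathbf{b}\in\mathbb{F}_q^m$ let $\chi_{\mathbf{a}}(\mathbf{b})=\prod_{i=1}^m\chi_{a_i}(b_i)$. On $\mathbb{C}^{q^m}$ with orthonormal basis $\{|\mathbf{x}\rangle\}_{\mathbf{x}\in\mathbb{F}_q^m}$: $\mathrm{QFT}|\mathbf{x}\rangle=q^{-m/2}\sum_{\mathbf{y}}\chi_{\mathbf{x}}(\mathbf{y})|\mathbf{y}\rangle$, $X_q^{\mathbf{v}}|\mathbf{x}\rangle=|\mathbf{x}+\mathbf{v}\rangle$, $Z_q^{\mathbf{v}}|\mathbf{x}\rangle=\chi_{\mathbf{v}}(\mathbf{x})|\mathbf{x}\rangle$. The Fourier transform $\widetilde P$ of $P$ is defined by $\sum_{\mathbf{x}}\widetilde P(\mathbf{x})|\mathbf{x}\rangle=\mathrm{QFT}\sum_{\mathbf{x}}P(\mathbf{x})|\mathbf{x}\rangle$. The dual code is $C^\perp=\{\mathbf{d}\in\mathbb{F}_q^m:\mathbf{d}\cdot\mathbf{c}=0\ \forall\mathbf{c}\in C\}$. Quantum decoding problem. $\mathrm{QDP}_{C^\perp,\widetilde P}$: given the state $\sum_{\mathbf{e}\in\mathbb{F}_q^m}\widetilde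 P(\mathbf{e})|\mathbf{d}+\mathbf{e}\rangle$ for uniformly random $\mathbf{d}\in C^\perp$, output $\mathbf{d}$. An algorithm for it is given by an ancilla space $\mathcal{H}_{\mathrm{anc}}$ (finite-dimensional) with a unit vector $|0_{\mathrm{anc}}\rangle$ and a unitary $U_{\mathrm{dec}}:\mathbb{C}^{q^m}\otimes\mathcal{H}_{\mathrm{anc}}\to\mathcal{G}\otimes\mathbb{C}^{q^m}$ ($\mathcal{G}$ a garbage space), after which the last register is measured in the standard basis. For $\mathbf{d}\in C^\perp$ write $$U_{\mathrm{dec}}\sum_{\mathbf{e}}\widetilde P(\mathbf{e})|\mathbf{d}+\mathbf{e}\rangle|0_{\mathrm{anc}}\rangle=\sqrt{1-\epsilon_{\mathbf{d}}}\,|\xi_{\mathbf{d}}\rangle|\mathbf{d}\rangle+\sqrt{\epsilon_{\mathbf{d}}}\,|\delta_{\mathbf{d}}\rangle,$$ with $|\xi_{\mathbf{d}}\rangle,|\delta_{\mathbf{d}}\rangle$ unit vectors and $|\delta_{\mathbf{d}}\rangle$ having zero amplitude on states whose last register is $|\mathbf{d}\rangle$. The success probability is $1-\epsilon$ with $\epsilon=\frac{1}{|C^\perp|}\sum_{\mathbf{d}\in C^\perp}\epsilon_{\mathbf{d}}$. Regev's reduction on input $\mathbf{v}$. Prepare $|C^\perp|^{-1/2}\sum_{\mathbf{d}\in C^\perp}|\mathbf{d}\rangle\otimes\sum_{\mathbf{e}}\widetilde P(\mathbf{e})|\mathbf{e}\rangle$; apply $Z_q^{-\mathbf{v}}$ to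 the first register; add the first register into the second; append $|0_{\mathrm{anc}}\rangle$ and apply $U_{\mathrm{dec}}$ to the second register and ancilla; postselect on the last register being equal to the first (restarting otherwise); subtract the last register from the first and discard the first; apply $U_{\mathrm{dec}}^\dagger$; apply $Z_q^{\mathbf{v}}$ to the ($q^m$-dimensional) first register. The resulting unit vector is $$|\Phi_{\mathrm{actual}}(\mathbf{v})\rangle=\mathcal{N}_{\mathrm{dec}}\,(Z_q^{\mathbf{v}}\otimes 1_{\mathrm{anc}})\,U_{\mathrm{dec}}^\dagger\sum_{\mathbf{d}\in C^\perp}\chi_{\mathbf{v}}(-\mathbf{d})\sqrt{1-\epsilon_{\mathbf{d}}}\,|\xi_{\mathbf{d}}\rangle|\mathbf{d}\rangle,$$ with $\mathcal{N}_{\mathrm{dec}}>0$ the normalization constant. Finally apply $\mathrm{QFT}^\dagger$ to the first register and condition on this register lying in $C$: with $\Pi_C=\sum_{\mathbf{c}\in C}|\mathbf{c}\rangle\langle\mathbf{c}|$, let $|\Psi(\mathbf{v})\rangle$ be the normalization of $(\Pi_C\mathrm{QFT}^\dagger\otimes 1_{\mathrm{anc}})|\Phi_{\mathrm{actual}}(\mathbf{v})\rangle$ (if this vector is zero, $|\Psi(\mathbf{v})\rangle$ is any fixed unit vector in the range of $\Pi_C\otimes 1_{\mathrm{anc}}$). Then $\rho(\mathbf{v})$ is the reduced state of $|\Psi(\mathbf{v})\rangle$ on the first register. *)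

theory Defs
  imports "HOL-Analysis.Analysis" "HOL-Computational_Algebra.Primes"
begin

text \<open>
  A finite-dimensional Hilbert space with orthonormal basis indexed by a finite type
  \<^typ>\<open>'x\<close> is \<^typ>\<open>complex ^ 'x\<close> (its library norm is the Hilbert norm), and an operator is its
  matrix.  A tensor product is indexed by the product type.
\<close>

section \<open>Linear algebra over finite-dimensional Hilbert spaces\<close>

definition cinner :: "complex ^ 'x::finite \<Rightarrow> complex ^ 'x \<Rightarrow> complex" where
  "cinner u w = (\<Sum>x\<in>UNIV. cnj (u $ x) * w $ x)"

definition adj :: "complex ^ 'x::finite ^ 'y::finite \<Rightarrow> complex ^ 'y ^ 'x" where
  "adj A = (\<chi> i j. cnj (A $ j $ i))"

definition unitary_op :: "complex ^ 'x::finite ^ 'y::finite \<Rightarrow> bool" where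
  "unitary_op U \<longleftrightarrow> adj U ** U = mat 1 \<and> U ** adj U = mat 1"

abbreviation ket :: "'x::finite \<Rightarrow> complex ^ 'x" where
  "ket x \<equiv> axis x 1"

definition tensor_vec :: "complex ^ 'x::finite \<Rightarrow> complex ^ 'y::finite \<Rightarrow> complex ^ ('x \<times> 'y)"
    (infixr "\<otimes>\<^sub>v" 75) where
  "u \<otimes>\<^sub>v w = (\<chi> k. u $ fst k * w $ snd k)"

definition tensor_op ::
    "complex ^ 'x::finite ^ 'y::finite \<Rightarrow> complex ^ 'z::finite ^ 'w::finite \<Rightarrow> complex ^ ('x \<times> 'z) ^ ('y \<times> 'w)"
    (infixr "\<otimes>\<^sub>m" 75) where
  "A \<otimes>\<^sub>m B = (\<chi> k l. A $ fst k $ fst l * B $ snd k $ snd l)"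

definition basis_map :: "('x::finite \<Rightarrow> 'y::finite) \<Rightarrow> complex ^ 'x ^ 'y" where
  \<comment> \<open>the linear map sending \<open>ket x\<close> to \<open>ket (f x)\<close>\<close>
  "basis_map f = (\<chi> y x. if y = f x then 1 else 0)"

definition diag_op :: "('x::finite \<Rightarrow> complex) \<Rightarrow> complex ^ 'x ^ 'x" where
  "diag_op f = (\<chi> y x. if y = x then f x else 0)"

definition basis_proj :: "'x::finite set \<Rightarrow> complex ^ 'x ^ 'x" where
  \<comment> \<open>the orthogonal projection onto the span of the kets indexed by \<open>A\<close>\<close>
  "basis_proj A = diag_op (\<lambda>x. if x \<in> A then 1 else 0)"

definition reduced_fst :: "complex ^ ('x::finite \<times> 'y::finite) \<Rightarrow> complex ^ 'x ^ 'x" where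
  \<comment> \<open>the partial trace over the second factor of the rank-one projection onto the vector\<close>
  "reduced_fst s = (\<chi> x x'. \<Sum>y\<in>UNIV. s $ (x, y) * cnj (s $ (x', y)))"

definition density_op :: "complex ^ 'x::finite ^ 'x \<Rightarrow> bool" where
  "density_op \<rho> \<longleftrightarrow>
     adj \<rho> = \<rho> \<and> (\<forall>u. cinner u (\<rho> *v u) \<in> \<real> \<and> 0 \<le> Re (cinner u (\<rho> *v u))) \<and> trace \<rho> = 1"

definition supported_on :: "complex ^ 'x::finite ^ 'x \<Rightarrow> 'x set \<Rightarrow> bool" where
  "supported_on \<rho> A \<longleftrightarrow> (\<forall>x y. \<rho> $ x $ y \<noteq> 0 \<longrightarrow> x \<in> A \<and> y \<in> A)"


section \<open>Characters, Fourier transform and Pauli operators over a finite field\<close>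

definition field_degree :: "'a::finite_field itself \<Rightarrow> nat" where
  "field_degree _ = (THE r. CARD('a) = CHAR('a) ^ r)"

definition field_trace :: "'a::finite_field \<Rightarrow> 'a" where
  "field_trace a = (\<Sum>i<field_degree TYPE('a). a ^ (CHAR('a) ^ i))"

definition prime_field_rep :: "'a::finite_field \<Rightarrow> nat" where
  \<comment> \<open>identifies the prime subfield with the integers modulo the characteristic\<close>
  "prime_field_rep t = (THE n. n < CHAR('a) \<and> of_nat n = t)"

definition chr :: "'a::finite_field \<Rightarrow> 'a \<Rightarrow> complex" where
  "chr a b = exp (2 * of_real pi * \<i> / of_nat CHAR('a)) ^ prime_field_rep (field_trace (a * b))"

definition chr_vec :: "'a::finite_field ^ 'm \<Rightarrow> 'a ^ 'm \<Rightarrow> complex" where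
  "chr_vec a b = (\<Prod>i\<in>UNIV. chr (a $ i) (b $ i))"

definition QFT :: "complex ^ ('a::finite_field ^ 'm) ^ ('a ^ 'm)" where
  "QFT = (\<chi> y x. of_real (real CARD('a) powr (- (real CARD('m) / 2))) * chr_vec x y)"

definition X_op :: "'a::finite_field ^ 'm \<Rightarrow> complex ^ ('a ^ 'm) ^ ('a ^ 'm)" where
  "X_op v = basis_map (\<lambda>x. x + v)"

definition Z_op :: "'a::finite_field ^ 'm \<Rightarrow> complex ^ ('a ^ 'm) ^ ('a ^ 'm)" where
  "Z_op v = diag_op (chr_vec v)"

definition dual_code :: "('a::finite_field ^ 'm) set \<Rightarrow> ('a ^ 'm) set" where
  "dual_code C = {d. \<forall>c\<in>C. (\<Sum>i\<in>UNIV. d $ i * c $ i) = 0}"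


section \<open>The quantum decoding problem\<close>

definition qdp_state ::
    "complex ^ ('a::finite_field ^ 'm) \<Rightarrow> 'a ^ 'm \<Rightarrow> complex ^ ('a ^ 'm)" where
  "qdp_state Q d = (\<Sum>e\<in>UNIV. Q $ e *s ket (d + e))"

text \<open>
  The decomposition of the decoder's output on the noisy version of \<open>d\<close> into the part where
  the last register equals \<open>d\<close> and the orthogonal part; \<open>\<epsilon>\<close> is thereby the probability that
  measuring the last register does not give \<open>d\<close>.
\<close>

definition qdp_decomposition ::
    "complex ^ (('a::finite_field ^ 'm) \<times> 'n::finite) ^ ('g::finite \<times> ('a ^ 'm)) \<Rightarrow> complex ^ 'n \<Rightarrow>
     complex ^ ('a ^ 'm) \<Rightarrow> 'a ^ 'm \<Rightarrow>
     real \<Rightarrow> complex ^ 'g \<Rightarrow> complex ^ ('g \<times> ('a ^ 'm)) \<Rightarrow> bool" where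
  "qdp_decomposition U anc Q d \<epsilon> \<xi> \<delta> \<longleftrightarrow>
     0 \<le> \<epsilon> \<and> \<epsilon> \<le> 1 \<and> norm \<xi> = 1 \<and> norm \<delta> = 1 \<and> (\<forall>g. \<delta> $ (g, d) = 0) \<and>
     U *v (qdp_state Q d \<otimes>\<^sub>v anc) =
       sqrt (1 - \<epsilon>) *\<^sub>R (\<xi> \<otimes>\<^sub>v ket d) + sqrt \<epsilon> *\<^sub>R \<delta>"


section \<open>Regev's reduction\<close>

text \<open>
  The reduction for a code with dual \<open>D\<close> and Fourier-transformed amplitudes \<open>Q\<close>.
  Postselection is a projection followed by normalization; \<^const>\<open>sgn\<close> is the normalization of a
  vector.
\<close>

definition regev_input ::
    "complex ^ ('a::finite_field ^ 'm) \<Rightarrow> ('a ^ 'm) set \<Rightarrow> complex ^ (('a ^ 'm) \<times> ('a ^ 'm))" where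
  "regev_input Q D =
     ((1 / sqrt (real (card D))) *\<^sub>R (\<Sum>d\<in>D. ket d)) \<otimes>\<^sub>v (\<Sum>e\<in>UNIV. Q $ e *s ket e)"

definition regev_encoded ::
    "complex ^ ('a::finite_field ^ 'm) \<Rightarrow> ('a ^ 'm) set \<Rightarrow> 'a ^ 'm \<Rightarrow>
     complex ^ (('a ^ 'm) \<times> ('a ^ 'm))" where
  "regev_encoded Q D v =
     basis_map (\<lambda>(d, e). (d, d + e)) *v ((Z_op (- v) \<otimes>\<^sub>m mat 1) *v regev_input Q D)"

definition regev_decoded ::
    "complex ^ (('a::finite_field ^ 'm) \<times> 'n::finite) ^ ('g::finite \<times> ('a ^ 'm)) \<Rightarrow> complex ^ 'n \<Rightarrow>
     complex ^ ('a ^ 'm) \<Rightarrow> ('a ^ 'm) set \<Rightarrow> 'a ^ 'm \<Rightarrow>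
     complex ^ (('a ^ 'm) \<times> 'g \<times> ('a ^ 'm))" where
  "regev_decoded U anc Q D v =
     (mat 1 \<otimes>\<^sub>m U) *v (basis_map (\<lambda>((d, y), a). (d, y, a)) *v (regev_encoded Q D v \<otimes>\<^sub>v anc))"

definition regev_postselected ::
    "complex ^ (('a::finite_field ^ 'm) \<times> 'n::finite) ^ ('g::finite \<times> ('a ^ 'm)) \<Rightarrow> complex ^ 'n \<Rightarrow>
     complex ^ ('a ^ 'm) \<Rightarrow> ('a ^ 'm) set \<Rightarrow> 'a ^ 'm \<Rightarrow>
     complex ^ (('a ^ 'm) \<times> 'g \<times> ('a ^ 'm))" where
  "regev_postselected U anc Q D v = sgn (basis_proj {(d, g, y). y = d} *v regev_decoded U anc Q D v)"

text \<open>
  After postselection and subtraction of the last register the first register is in the basis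
  state \<open>0\<close>, so discarding it leaves the amplitudes at \<open>0\<close>.
\<close>

definition regev_actual ::
    "complex ^ (('a::finite_field ^ 'm) \<times> 'n::finite) ^ ('g::finite \<times> ('a ^ 'm)) \<Rightarrow> complex ^ 'n \<Rightarrow>
     complex ^ ('a ^ 'm) \<Rightarrow> ('a ^ 'm) set \<Rightarrow> 'a ^ 'm \<Rightarrow> complex ^ (('a ^ 'm) \<times> 'n)" where
  "regev_actual U anc Q D v =
     (let s = basis_map (\<lambda>(d, g, y). (d - y, g, y)) *v regev_postselected U anc Q D v
      in (Z_op v \<otimes>\<^sub>m mat 1) *v (adj U *v (\<chi> k. s $ (0, k))))"

text \<open>
  If the decoder succeeds with positive probability, \<^term>\<open>regev_actual\<close> is a unit vector; it
  is computed in closed form in \<open>regev_actual_closed_form\<close> below.  In the next definition \<open>fb\<close> is the state used when the register lies in the code with probability zero.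
\<close>

definition regev_final ::
    "complex ^ (('a::finite_field ^ 'm) \<times> 'n::finite) ^ ('g::finite \<times> ('a ^ 'm)) \<Rightarrow> complex ^ 'n \<Rightarrow>
     complex ^ ('a ^ 'm) \<Rightarrow> ('a ^ 'm) set \<Rightarrow> complex ^ (('a ^ 'm) \<times> 'n) \<Rightarrow> 'a ^ 'm \<Rightarrow>
     complex ^ (('a ^ 'm) \<times> 'n)" where
  "regev_final U anc Q C fb v =
     (let w = ((basis_proj C ** adj QFT) \<otimes>\<^sub>m mat 1) *v regev_actual U anc Q (dual_code C) v
      in if w = 0 then fb else sgn w)"

definition regev_output ::
    "complex ^ (('a::finite_field ^ 'm) \<times> 'n::finite) ^ ('g::finite \<times> ('a ^ 'm)) \<Rightarrow> complex ^ 'n \<Rightarrow>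
     complex ^ ('a ^ 'm) \<Rightarrow> ('a ^ 'm) set \<Rightarrow> complex ^ (('a ^ 'm) \<times> 'n) \<Rightarrow> 'a ^ 'm \<Rightarrow>
     complex ^ ('a ^ 'm) ^ ('a ^ 'm)" where
  "regev_output U anc Q C fb v = reduced_fst (regev_final U anc Q C fb v)"


subsection \<open>The state before the final Fourier transform in closed form\<close>

lemma basis_map_nth: "(basis_map f *v s) $ y = (\<Sum>x | f x = y. s $ x)"
proof -
  have "(basis_map f *v s) $ y = (\<Sum>x\<in>UNIV. if f x = y then s $ x else 0)"
    unfolding basis_map_def matrix_vector_mult_def vec_lambda_beta by (rule sum.cong) auto
  then show ?thesis by (simp add: sum.If_cases)
qed

lemma diag_op_nth: "(diag_op f *v s) $ y = f y * s $ y"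
proof -
  have "(diag_op f *v s) $ y = (\<Sum>x\<in>UNIV. if x = y then f x * s $ x else 0)"
    unfolding diag_op_def matrix_vector_mult_def vec_lambda_beta by (rule sum.cong) auto
  then show ?thesis by simp
qed

lemma tensor_op_left_nth: "((A \<otimes>\<^sub>m mat 1) *v s) $ (i, j) = (A *v (\<chi> k. s $ (k, j))) $ i"
proof -
  have "((A \<otimes>\<^sub>m mat 1) *v s) $ (i, j) =
      (\<Sum>k\<in>UNIV. \<Sum>l\<in>UNIV. A $ i $ k * (if j = l then 1 else 0) * s $ (k, l))"
    unfolding tensor_op_def matrix_vector_mult_def mat_def
    by (simp add: UNIV_Times_UNIV[symmetric] sum.cartesian_product case_prod_beta del: UNIV_Times_UNIV)
  also have "\<dots> = (\<Sum>k\<in>UNIV. \<Sum>l\<in>UNIV. if j = l then A $ i $ k * s $ (k, l) else 0)"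
    by (intro sum.cong) auto
  finally show ?thesis by (simp add: matrix_vector_mult_def)
qed

lemma tensor_op_right_nth: "((mat 1 \<otimes>\<^sub>m A) *v s) $ (i, j) = (A *v (\<chi> k. s $ (i, k))) $ j"
proof -
  have "((mat 1 \<otimes>\<^sub>m A) *v s) $ (i, j) =
      (\<Sum>k\<in>UNIV. \<Sum>l\<in>UNIV. (if i = k then 1 else 0) * A $ j $ l * s $ (k, l))"
    unfolding tensor_op_def matrix_vector_mult_def mat_def
    by (simp add: UNIV_Times_UNIV[symmetric] sum.cartesian_product case_prod_beta del: UNIV_Times_UNIV)
  also have "\<dots> = (\<Sum>k\<in>UNIV. if i = k then \<Sum>l\<in>UNIV. A $ j $ l * s $ (k, l) else 0)"
    by (intro sum.cong) auto
  finally show ?thesis by (simp add: matrix_vector_mult_def)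
qed

lemma matrix_vector_mult_scaleR_complex:
  "(A :: complex ^ 'x ^ 'y) *v (r *\<^sub>R s) = r *\<^sub>R (A *v s)"
  by (simp add: vec_eq_iff matrix_vector_mult_def scaleR_sum_right)

lemma chr_vec_uminus: "chr_vec (- v) d = chr_vec v (- d)"
  by (simp add: chr_vec_def chr_def)

lemma qdp_state_nth: "qdp_state Q d $ y = Q $ (y - d)"
proof -
  have "qdp_state Q d $ y = (\<Sum>e\<in>UNIV. if e = y - d then Q $ e else 0)"
    unfolding qdp_state_def axis_def sum_component by (rule sum.cong) auto
  then show ?thesis by simp
qed

lemma regev_encoded_nth:
  "regev_encoded Q D v $ (d, y) =
     (if d \<in> D then chr_vec v (- d) / sqrt (card D) else 0) * qdp_state Q d $ y"
proof -
  have fin: "finite D" by simp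
  have pre: "{x. (case x of (d', e) \<Rightarrow> (d', d' + e)) = (d, y)} = {(d, y - d)}"
    by auto
  have D: "(\<Sum>d\<in>D. ket d) $ x = (if x \<in> D then 1 else 0 :: complex)" for x
    using fin by (simp add: axis_def if_distrib sum.If_cases)
  have e: "(\<Sum>e\<in>UNIV. Q $ e *s ket e) $ x = Q $ x" for x
    using qdp_state_nth[of Q 0 x] by (simp add: qdp_state_def)
  show ?thesis
    unfolding regev_encoded_def regev_input_def basis_map_nth pre
    by (simp add: tensor_op_left_nth Z_op_def diag_op_nth tensor_vec_def D e
        qdp_state_nth chr_vec_uminus scaleR_conv_of_real[where 'a = complex] divide_inverse of_real_inverse del: sum_component)
qed

lemma regev_decoded_nth:
  fixes U :: "complex ^ (('a::finite_field ^ 'm) \<times> 'n::finite) ^ ('g::finite \<times> ('a ^ 'm))"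
  shows "regev_decoded U anc Q D v $ (d, k) =
     (if d \<in> D then chr_vec v (- d) / sqrt (card D) else 0) * (U *v (qdp_state Q d \<otimes>\<^sub>v anc)) $ k"
proof -
  have pre: "{x. (case x of (x, xa) \<Rightarrow> (case x of (d, y) \<Rightarrow> \<lambda>a. (d, y, a)) xa) = (d, j)} = {((d, fst j), snd j)}" for d :: "'a ^ 'm" and j :: "('a ^ 'm) \<times> 'n"
    by auto
  define c :: complex where "c = (if d \<in> D then chr_vec v (- d) / sqrt (card D) else 0)"
  have "regev_decoded U anc Q D v $ (d, k) = (U *v (c *s (qdp_state Q d \<otimes>\<^sub>v anc))) $ k"
    unfolding regev_decoded_def tensor_op_right_nth basis_map_nth pre
    by (rule arg_cong[where f = "\<lambda>w. (U *v w) $ k"])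
      (simp add: tensor_vec_def regev_encoded_nth c_def vec_eq_iff)
  then show ?thesis
    by (simp add: vector_scalar_commute flip: c_def)
qed

text \<open>
  The normalized state before the final Fourier transform, in terms of the decoder's successful
  part.
\<close>

lemma regev_actual_closed_form:
  fixes U :: "complex ^ (('a::finite_field ^ 'm) \<times> 'n::finite) ^ ('g::finite \<times> ('a ^ 'm))"
    and v :: "'a ^ 'm"
  assumes dec: "\<And>d. d \<in> D \<Longrightarrow> qdp_decomposition U anc Q d (\<epsilon> d) (\<xi> d) (\<delta> d)"
  defines "t \<equiv> basis_proj {(d, g, y). y = d} *v regev_decoded U anc Q D v"
  shows "regev_actual U anc Q D v =
      (1 / (norm t * sqrt (card D))) *\<^sub>R ((Z_op v \<otimes>\<^sub>m mat 1) *v (adj U *v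
         (\<Sum>d\<in>D. (chr_vec v (- d) * complex_of_real (sqrt (1 - \<epsilon> d))) *s (\<xi> d \<otimes>\<^sub>v ket d))))"
    (is "_ = _ *\<^sub>R (?Z *v (_ *v ?S))")
proof -
  let ?s = "basis_map (\<lambda>(d, g, y). (d - y, g, y)) *v regev_postselected U anc Q D v"
  have pre: "{x. (case x of (d, g, y) \<Rightarrow> (d - y, g, y)) = (0, k)} = {(snd k, k)}"
    for k :: "'g \<times> ('a ^ 'm)"
    by auto
  have "(\<chi> k. ?s $ (0, k)) = (1 / (norm t * sqrt (card D))) *\<^sub>R ?S"
  proof (subst vec_eq_iff, intro allI)
    fix k :: "'g \<times> ('a ^ 'm)"
    obtain g y where k: "k = (g, y)" by fastforce
    have fin: "finite D" by simp
    have S: "?S $ k = (if y \<in> D then chr_vec v (- y) * sqrt (1 - \<epsilon> y) * \<xi> y $ g else 0)"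
      using fin by (simp add: k tensor_vec_def axis_def if_distrib sum.If_cases cong: if_cong)
    have "(\<chi> k. ?s $ (0, k)) $ k = inverse (norm t) *\<^sub>R t $ (y, g, y)"
      by (simp add: basis_map_nth pre k regev_postselected_def sgn_div_norm t_def divide_inverse)
    also have "t $ (y, g, y) =
        (if y \<in> D then chr_vec v (- y) / sqrt (card D) else 0) *
           (U *v (qdp_state Q y \<otimes>\<^sub>v anc)) $ (g, y)"
      by (simp add: t_def basis_proj_def diag_op_nth regev_decoded_nth)
    also have "\<dots> = (if y \<in> D then chr_vec v (- y) / sqrt (card D) * (sqrt (1 - \<epsilon> y) * \<xi> y $ g) else 0)"
      using dec[of y] unfolding qdp_decomposition_def
      by (auto simp: tensor_vec_def scaleR_conv_of_real[where 'a = complex])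
    finally show "(\<chi> k. ?s $ (0, k)) $ k = ((1 / (norm t * sqrt (card D))) *\<^sub>R ?S) $ k"
      unfolding vector_scaleR_component S
      by (simp add: scaleR_conv_of_real[where 'a = complex] divide_inverse)
  qed
  then show ?thesis
    by (simp add: regev_actual_def Let_def matrix_vector_mult_scaleR_complex)
qed

end

theory Submission
  imports Defs "HOL-Number_Theory.Cong"
begin

text \<open>
  Undoing the decoder on its exact output, instead of on the successful part only, would give
  \<open>I v = \<surd>|C\<^sup>\<bottom>| \<Sum>c\<in>C. P(c - v) |c\<rangle>|0\<rangle>\<close>, supported on \<open>C\<close>, for which the average of the objective
  is exactly the one of \<open>P\<close>.  Let \<open>A v\<close> be the state that the reduction really reaches before it
  conditions on \<open>C\<close>.  The phases \<open>\<chi>\<^sub>v(-d)\<close> of distinct dual codewords are orthogonal as functions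
  of \<open>v\<close>, so on average over \<open>v\<close> both families have norm 1 and their overlap is \<open>\<surd>(1 - \<epsilon>)\<close>;
  cross terms with the failed branches disappear.  Since the objective restricted to \<open>C\<close> lies
  between 0 and 1, Cauchy-Schwarz for \<open>|I|\<^sup>2 - |A|\<^sup>2 = \<langle>I - A, I + A\<rangle>\<close> bounds the loss by
  \<open>\<surd>(2 - 2\<surd>(1 - \<epsilon>)) \<cdot> \<surd>(2 + 2\<surd>(1 - \<epsilon>)) = 2\<surd>\<epsilon>\<close>.  Normalizing after conditioning on \<open>C\<close> can
  only increase the objective.
\<close>

section \<open>Finite fields\<close>

text \<open>An additive subgroup of order a power of the characteristic which is not the whole field
  can be enlarged by the factor \<open>CHAR('a)\<close>, so a maximal one is everything.\<close>

lemma finite_field_card_eq_CHAR_power: "\<exists>r. CARD('a::finite_field) = CHAR('a) ^ r"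
proof -
  let ?p = "CHAR('a)"
  define good where "good H \<longleftrightarrow> 0 \<in> H \<and> (\<forall>x\<in>H. \<forall>y\<in>H. x - y \<in> H) \<and>
      (\<forall>x\<in>H. \<forall>n. of_nat n * x \<in> H) \<and> (\<exists>r. card H = ?p ^ r)" for H :: "'a set"
  have "good {0}"
    by (auto simp: good_def intro!: exI[of _ 0])
  moreover have "\<forall>H. good H \<longrightarrow> card H < Suc CARD('a)"
    by (simp add: less_Suc_eq_le card_mono)
  ultimately obtain H where H: "good H" and max: "\<And>H'. good H' \<Longrightarrow> card H' \<le> card H"
    using ex_has_greatest_nat by metis
  obtain r where r: "card H = ?p ^ r"
    using H by (auto simp: good_def)
  have zero: "0 \<in> H" and diff: "\<And>x y. x \<in> H \<Longrightarrow> y \<in> H \<Longrightarrow> x - y \<in> H"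
    and mul: "\<And>x n. x \<in> H \<Longrightarrow> of_nat n * x \<in> H"
    using H by (auto simp: good_def)
  have "H = UNIV"
  proof (rule ccontr)
    assume "H \<noteq> UNIV"
    then obtain a where a: "a \<notin> H" by auto
    \<comment> \<open>The image of \<open>f\<close> is the sum of \<open>H\<close> and the
      prime-field multiples of \<open>a\<close>; injectivity makes it larger than \<open>H\<close>
      by the factor \<open>CHAR('a)\<close>.\<close>
    define f where "f = (\<lambda>(h, n::nat). h + of_nat n * a)"
    have red: "h + of_nat n * a \<in> f ` (H \<times> {..<?p})" if "h \<in> H" for h n
      using that by (intro image_eqI[of _ _ "(h, n mod ?p)"])
        (auto simp: f_def of_nat_eq_iff_cong_CHAR cong_def)
    have inj: "inj_on f (H \<times> {..<?p})"
    proof -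
      have False if "h \<in> H" "h' \<in> H" "n < n'" "n' < ?p"
        and eq: "h + of_nat n * a = h' + of_nat n' * a" for h h' n n'
      proof -
        define d :: 'a where "d = of_nat (n' - n)"
        have "d \<noteq> 0"
          unfolding d_def of_nat_eq_0_iff_char_dvd using that by (auto dest: dvd_imp_le)
        have q: "CARD('a) \<ge> 2"
          using card_mono[of "UNIV :: 'a set" "{0, 1}"] by auto
        \<comment> \<open>The inverse of \<open>d\<close> is written as a power of \<open>d\<close>
          because such a power is again the image of a natural number, and \<open>H\<close> is
          closed under multiplication by those.\<close>
        have "d ^ (CARD('a) - 2) * (d * d) = d"
          using finite_field_power_card_eq_same[of d] q
          by (metis le_add_diff_inverse2 power2_eq_square power_add)
        then have inv: "d ^ (CARD('a) - 2) * d = 1"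
          using \<open>d \<noteq> 0\<close> by (metis mult.assoc mult_cancel_right1)
        have "d * a = h - h'"
          using eq that by (simp add: d_def of_nat_diff algebra_simps)
        then have "a = d ^ (CARD('a) - 2) * (h - h')"
          using inv by (metis mult.assoc mult_1)
        also have "\<dots> = of_nat ((n' - n) ^ (CARD('a) - 2)) * (h - h')"
          by (simp add: d_def)
        also have "\<dots> \<in> H"
          using that by (intro mul diff)
        finally show False using a by simp
      qed
      note neq = this
      show ?thesis
        by (auto simp: inj_on_def f_def) (metis neq nat_neq_iff add_right_imp_eq)+
    qed
    have card: "card (f ` (H \<times> {..<?p})) = ?p ^ Suc r"
      using inj by (simp add: card_image card_cartesian_product r)
    have "good (f ` (H \<times> {..<?p}))"
      unfolding good_def
    proof (intro conjI ballI allI)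
      show "0 \<in> f ` (H \<times> {..<?p})"
        using red[OF zero, of 0] by simp
    next
      fix x y assume "x \<in> f ` (H \<times> {..<?p})" "y \<in> f ` (H \<times> {..<?p})"
      then obtain h n h' n' where *: "h \<in> H" "h' \<in> H" "x = h + of_nat n * a"
          "y = h' + of_nat n' * a" "n' < ?p"
        by (auto simp: f_def)
      have "x - y = (h - h') + of_nat (n + (?p - n')) * a"
        using * by (simp add: of_nat_diff algebra_simps)
      then show "x - y \<in> f ` (H \<times> {..<?p})"
        using red diff * by metis
    next
      fix x and k :: nat assume "x \<in> f ` (H \<times> {..<?p})"
      then obtain h n where *: "h \<in> H" "x = h + of_nat n * a"
        by (auto simp: f_def)
      have "of_nat k * x = of_nat k * h + of_nat (k * n) * a"
        using * by (simp add: algebra_simps)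
      then show "of_nat k * x \<in> f ` (H \<times> {..<?p})"
        using red mul * by metis
    qed (use card in blast)
    from max[OF this] show False
      using prime_gt_1_nat[OF CHAR_prime[where 'a = 'a]] unfolding card r by simp
  qed
  then show ?thesis using r by auto
qed

lemma card_eq_CHAR_power_field_degree:
  "CARD('a::finite_field) = CHAR('a) ^ field_degree TYPE('a)"
proof -
  have "\<exists>!r. CARD('a) = CHAR('a) ^ r"
    using finite_field_card_eq_CHAR_power[where 'a = 'a] prime_gt_1_nat[OF CHAR_prime[where 'a = 'a]]
    by (metis power_inject_exp)
  then show ?thesis
    unfolding field_degree_def by (rule theI')
qed

lemma field_degree_pos: "field_degree TYPE('a::finite_field) > 0"
proof (rule ccontr)
  assume "\<not> ?thesis"
  then have "CARD('a) = 1"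
    using card_eq_CHAR_power_field_degree[where 'a = 'a] by simp
  then show False
    using card_mono[of "UNIV :: 'a set" "{0, 1}"] by auto
qed

section \<open>The field trace and the prime subfield\<close>

lemma field_trace_add: "field_trace (a + b) = field_trace a + field_trace b"
  by (simp add: field_trace_def freshmans_dream' sum.distrib)

text \<open>Frobenius shifts the summands cyclically: the last one returns to \<open>a\<close>,
  since raising to the order of the field is the identity.\<close>

lemma field_trace_power_CHAR: "field_trace a ^ CHAR('a) = field_trace (a :: 'a::finite_field)"
proof -
  let ?p = "CHAR('a)"
  obtain r where r: "field_degree TYPE('a) = Suc r"
    using field_degree_pos[where 'a = 'a] gr0_implies_Suc by auto
  have last: "a ^ (?p ^ Suc r) = a"
    using finite_field_power_card_eq_same[of a] card_eq_CHAR_power_field_degree[where 'a = 'a] r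
    by metis
  have "field_trace a ^ ?p = (\<Sum>i<Suc r. (a ^ (?p ^ i)) ^ ?p)"
    unfolding field_trace_def r by (rule freshmans_dream_sum) auto
  also have "\<dots> = (\<Sum>i<Suc r. a ^ (?p ^ Suc i))"
    by (simp add: mult.commute flip: power_mult)
  also have "\<dots> = (\<Sum>i<r. a ^ (?p ^ Suc i)) + a"
    using last by simp
  also have "\<dots> = (\<Sum>i<Suc r. a ^ (?p ^ i))"
    by (subst sum.lessThan_Suc_shift) simp
  finally show ?thesis
    by (simp add: field_trace_def r)
qed

text \<open>The trace is a polynomial function whose degree is smaller than the order of the field,
  so it cannot vanish everywhere. The polynomial is nonzero because its linear coefficient comes
  from the summand \<open>i = 0\<close> alone.\<close>

lemma field_trace_nonzero: "\<exists>a :: 'a::finite_field. field_trace a \<noteq> 0"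
proof (rule ccontr)
  let ?p = "CHAR('a)"
  obtain r where r: "field_degree TYPE('a) = Suc r"
    using field_degree_pos[where 'a = 'a] gr0_implies_Suc by auto
  have p: "?p > 1"
    using prime_gt_1_nat by auto
  define f :: "'a poly" where "f = (\<Sum>i<Suc r. monom 1 (?p ^ i))"
  assume "\<nexists>a :: 'a. field_trace a \<noteq> 0"
  then have "{a. poly f a = 0} = UNIV"
    by (simp add: f_def poly_sum poly_monom field_trace_def r)
  moreover have "coeff f 1 = (\<Sum>i<Suc r. if i = 0 then 1 else 0)"
    unfolding f_def coeff_sum coeff_monom using p by (intro sum.cong) auto
  then have "coeff f 1 = 1"
    by simp
  then have "f \<noteq> 0" by auto
  moreover have "degree f \<le> ?p ^ r"
    unfolding f_def using p
    by (intro degree_sum_le) (auto intro!: order.trans[OF degree_monom_le] power_increasing)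
  ultimately have "CARD('a) \<le> ?p ^ r"
    using card_poly_roots_bound[of f] by simp
  then show False
    using card_eq_CHAR_power_field_degree[where 'a = 'a] r p by simp
qed

text \<open>The prime subfield supplies as many distinct roots of the polynomial \<open>f\<close> as
  its degree allows, so there are no others.\<close>

lemma power_CHAR_eq_self_iff:
  "t ^ CHAR('a) = (t :: 'a::finite_field) \<longleftrightarrow> t \<in> of_nat ` {..<CHAR('a)}"
proof -
  let ?p = "CHAR('a)"
  have p: "?p > 1"
    using prime_gt_1_nat by auto
  have of_nat: "of_nat n ^ ?p = (of_nat n :: 'a)" for n
    using p by (induction n) (auto simp: freshmans_dream power_0_left)
  define f :: "'a poly" where "f = monom 1 ?p - monom 1 1"
  have "coeff f ?p = 1"
    using p by (simp add: f_def)
  then have "f \<noteq> 0" by auto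
  have "degree f \<le> ?p"
    unfolding f_def using p by (intro degree_diff_le) (auto simp: degree_monom_eq)
  have roots: "{t. poly f t = 0} = {t. t ^ ?p = t}"
    by (simp add: f_def poly_monom)
  have card: "card (of_nat ` {..<?p} :: 'a set) = ?p"
    by (subst card_image) (auto simp: inj_on_def of_nat_eq_iff_cong_CHAR cong_def)
  have "of_nat ` {..<?p} = {t :: 'a. t ^ ?p = t}"
  proof (rule card_seteq)
    show "card {t :: 'a. t ^ ?p = t} \<le> card (of_nat ` {..<?p} :: 'a set)"
      using card_poly_roots_bound[OF \<open>f \<noteq> 0\<close>] \<open>degree f \<le> ?p\<close> card roots by simp
  qed (use of_nat in auto)
  then show ?thesis by auto
qed

lemma prime_field_rep_of_nat: "prime_field_rep (of_nat n :: 'a::finite_field) = n mod CHAR('a)"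
  unfolding prime_field_rep_def
  by (rule the_equality) (auto simp: of_nat_eq_iff_cong_CHAR cong_def)

section \<open>Characters\<close>

text \<open>The one-variable character behind \<open>chr\<close>: \<open>chr a b\<close> is
  \<open>add_chr (a * b)\<close>, so multiplicativity is proved only once.\<close>

definition add_chr :: "'a::finite_field \<Rightarrow> complex" where
  "add_chr t = exp (2 * of_real pi * \<i> / of_nat CHAR('a)) ^ prime_field_rep (field_trace t)"

text \<open>\<open>prime_field_rep\<close> is additive only modulo the characteristic; the powers of
  the root of unity do not see this reduction.\<close>

lemma primitive_root_power_mod:
  assumes "n > 0"
  shows "exp (2 * of_real pi * \<i> / of_nat n) ^ (k mod n) = exp (2 * of_real pi * \<i> / of_nat n) ^ k"
proof -
  have "exp (2 * of_real pi * \<i> / of_nat n) ^ n = 1"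
    using assms by (simp flip: exp_of_nat_mult)
  then show ?thesis
    by (metis mod_mult_div_eq mult.right_neutral power_add power_mult power_one)
qed

text \<open>Being fixed by Frobenius, the trace lies in the prime subfield, where
  \<open>prime_field_rep\<close> is well defined.\<close>

lemma field_trace_eq_of_nat: "\<exists>n. field_trace (a :: 'a::finite_field) = of_nat n"
  using field_trace_power_CHAR[of a] power_CHAR_eq_self_iff by fastforce

lemma add_chr_add: "add_chr (s + t) = add_chr s * add_chr (t :: 'a::finite_field)"
proof -
  obtain k l where kl: "field_trace s = of_nat k" "field_trace t = of_nat l"
    using field_trace_eq_of_nat by metis
  then have "field_trace (s + t) = of_nat (k + l)"
    by (simp add: field_trace_add)
  with kl show ?thesis
    unfolding add_chr_def by (simp only: prime_field_rep_of_nat primitive_root_power_mod[OF CHAR_pos] power_add)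
qed

lemma add_chr_0: "add_chr 0 = 1"
  using add_chr_add[of 0 0] by (simp add: add_chr_def)

lemma norm_add_chr: "norm (add_chr t) = 1"
proof -
  have "norm (exp (2 * of_real pi * \<i> / of_nat n :: complex)) = 1" for n
    by (simp add: norm_exp_eq_Re)
  then show ?thesis
    by (simp add: add_chr_def norm_power)
qed

lemma add_chr_nontrivial: "\<exists>t :: 'a::finite_field. add_chr t \<noteq> 1"
proof -
  obtain t :: 'a where t: "field_trace t \<noteq> 0"
    using field_trace_nonzero by blast
  obtain k where k: "field_trace t = of_nat k"
    using field_trace_eq_of_nat by blast
  with t have "0 < k mod CHAR('a)"
    by (metis mod_0_imp_dvd neq0_conv of_nat_eq_0_iff_char_dvd)
  moreover have "k mod CHAR('a) < CHAR('a)"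
    by simp
  moreover have "add_chr t = exp (2 * of_real pi * \<i> * of_nat (k mod CHAR('a)) / of_nat CHAR('a))"
    unfolding add_chr_def k prime_field_rep_of_nat by (simp add: mult_ac flip: exp_of_nat_mult)
  ultimately show ?thesis
    using complex_root_unity_eq_1[of "CHAR('a)" "k mod CHAR('a)"]
    by (metis CHAR_pos One_nat_def Suc_leI nat_dvd_not_less)
qed

lemma chr_vec_eq: "chr_vec a b = add_chr (scalar_product a b)"
proof -
  have "add_chr (\<Sum>i\<in>A. a $ i * b $ i) = (\<Prod>i\<in>A. add_chr (a $ i * b $ i))" for A
    by (induction A rule: infinite_finite_induct) (auto simp: add_chr_0 add_chr_add)
  then show ?thesis
    by (simp add: chr_vec_def chr_def add_chr_def scalar_product_def)
qed

lemma chr_vec_commute: "chr_vec a b = chr_vec b a"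
  by (simp add: chr_vec_eq scalar_product_def mult.commute)

lemma chr_vec_add_right: "chr_vec a (b + c) = chr_vec a b * chr_vec a c"
  by (simp add: chr_vec_eq scalar_product_def ring_distribs sum.distrib add_chr_add)

lemma chr_vec_add_left: "chr_vec (a + b) c = chr_vec a c * chr_vec b c"
  by (metis chr_vec_add_right chr_vec_commute)

lemma chr_vec_diff_right: "chr_vec a (b - c) = chr_vec a b * chr_vec a (- c)"
  using chr_vec_add_right[of a b "- c"] by simp

lemma chr_vec_diff_left: "chr_vec (a - b) c = chr_vec a c * chr_vec b (- c)"
  using chr_vec_add_left[of a "- b" c] by (simp add: chr_vec_uminus)

lemma chr_vec_0_right: "chr_vec a 0 = 1"
  by (simp add: chr_vec_eq scalar_product_def add_chr_0)

lemma norm_chr_vec: "norm (chr_vec a b) = 1"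
  by (simp add: chr_vec_eq norm_add_chr)

lemma cnj_chr_vec: "cnj (chr_vec a b) = chr_vec a (- b)"
proof -
  have "chr_vec a (- b) * chr_vec a b = 1"
    by (simp add: chr_vec_0_right flip: chr_vec_add_right)
  moreover have "cnj (chr_vec a b) * chr_vec a b = 1"
    using norm_chr_vec[of a b] complex_norm_square[of "chr_vec a b"] by (simp add: mult.commute)
  ultimately show ?thesis
    by (metis mult_cancel_right zero_neq_one mult_zero_right)
qed

section \<open>Character orthogonality and the dual code\<close>

lemma sum_chr_vec_subspace:
  fixes C :: "('a::finite_field ^ 'm) set"
  assumes "vec.subspace C"
  shows "(\<Sum>c\<in>C. chr_vec d c) = (if d \<in> dual_code C then of_nat (card C) else 0)"
proof (cases "d \<in> dual_code C")
  case True
  then have "chr_vec d c = 1" if "c \<in> C" for c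
    using that by (simp add: chr_vec_eq scalar_product_def dual_code_def add_chr_0)
  with True show ?thesis by simp
next
  case False
  then obtain c where c: "c \<in> C" "scalar_product d c \<noteq> 0"
    by (auto simp: dual_code_def scalar_product_def)
  obtain t :: 'a where t: "add_chr t \<noteq> 1"
    using add_chr_nontrivial by blast
  \<comment> \<open>\<open>c\<close> is rescaled so that its product with \<open>d\<close> becomes
    \<open>t\<close>: a nonzero product alone does not give a nontrivial character value, as its
    trace may vanish.\<close>
  define b where "b = (t / scalar_product d c) *s c"
  have b: "b \<in> C"
    unfolding b_def using assms c by (simp add: vec.subspace_scale)
  have "scalar_product d b = (t / scalar_product d c) * scalar_product d c"
    unfolding b_def scalar_product_def sum_distrib_left by (simp add: mult_ac)
  then have nontriv: "chr_vec d b \<noteq> 1"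
    using c t by (simp add: chr_vec_eq)
  \<comment> \<open>Translation by \<open>b\<close> permutes \<open>C\<close> but multiplies the sum
    by a factor other than 1, so the sum is 0.\<close>
  have "(\<Sum>c\<in>C. chr_vec d c) = (\<Sum>c\<in>C. chr_vec d (c + b))"
    by (rule sum.reindex_bij_witness[of _ "\<lambda>c. c + b" "\<lambda>c. c - b"])
      (use assms b in \<open>auto simp: vec.subspace_add vec.subspace_diff\<close>)
  also have "\<dots> = (\<Sum>c\<in>C. chr_vec d c) * chr_vec d b"
    by (simp add: chr_vec_add_right sum_distrib_right)
  finally show ?thesis
    using nontriv False by simp
qed

lemma sum_chr_vec_UNIV:
  "(\<Sum>x\<in>UNIV. chr_vec d x) =
    (if d = 0 then of_nat CARD('a ^ 'm) else 0)" for d :: "'a::finite_field ^ 'm"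
proof -
  have "d = 0" if "d \<in> dual_code UNIV"
  proof -
    have "(\<Sum>i\<in>UNIV. d $ i * axis j 1 $ i) = 0" for j
      using that by (auto simp: dual_code_def)
    then show "d = 0"
      by (simp add: axis_def vec_eq_iff if_distrib cong: if_cong)
  qed
  then have "d \<in> dual_code UNIV \<longleftrightarrow> d = 0"
    by (auto simp: dual_code_def)
  then show ?thesis
    using sum_chr_vec_subspace[OF vec.subspace_UNIV, of d] by (simp del: CARD_vec)
qed

text \<open>Replacing the indicator function of the dual code by the character sum over \<open>C\<close> and
  exchanging the two sums gives the bidual without a dimension count.\<close>

lemma sum_chr_vec_dual_code:
  fixes C :: "('a::finite_field ^ 'm) set"
  assumes "vec.subspace C"
  shows "of_nat (card C) * (\<Sum>d\<in>dual_code C. chr_vec d x) =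
    (if x \<in> C then of_nat CARD('a ^ 'm) else 0)"
proof -
  have "of_nat (card C) * (\<Sum>d\<in>dual_code C. chr_vec d x) =
      (\<Sum>d\<in>dual_code C. (\<Sum>c\<in>C. chr_vec d c) * chr_vec d x)"
    using assms by (simp add: sum_chr_vec_subspace sum_distrib_left)
  also have "\<dots> = (\<Sum>d\<in>UNIV. (\<Sum>c\<in>C. chr_vec d c) * chr_vec d x)"
    using assms by (intro sum.mono_neutral_left) (auto simp: sum_chr_vec_subspace)
  also have "\<dots> = (\<Sum>c\<in>C. \<Sum>d\<in>UNIV. chr_vec (c + x) d)"
    unfolding sum_distrib_right
    by (subst sum.swap) (simp add: chr_vec_commute[of "_ + _"] chr_vec_add_right)
  also have "\<dots> = (\<Sum>c\<in>C. if c = - x then of_nat CARD('a ^ 'm) else 0)"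
    by (simp add: sum_chr_vec_UNIV eq_neg_iff_add_eq_0 del: CARD_vec)
  also have "\<dots> = (if - x \<in> C then of_nat CARD('a ^ 'm) else 0)"
    by (simp del: CARD_vec)
  also have "- x \<in> C \<longleftrightarrow> x \<in> C"
    using assms vec.subspace_neg by fastforce
  finally show ?thesis .
qed

lemma card_dual_code:
  fixes C :: "('a::finite_field ^ 'm) set"
  assumes "vec.subspace C"
  shows "card C * card (dual_code C) = CARD('a ^ 'm)"
proof -
  have "(of_nat (card C * card (dual_code C)) :: complex) = of_nat CARD('a ^ 'm)"
    using sum_chr_vec_dual_code[OF assms, of 0] vec.subspace_0[OF assms]
    by (simp add: chr_vec_0_right del: CARD_vec)
  then show ?thesis
    unfolding of_nat_eq_iff .
qed

lemma card_dual_code_pos: "card (dual_code C) > 0"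
proof -
  have "0 \<in> dual_code C"
    by (simp add: dual_code_def)
  then show ?thesis
    by (auto simp: card_gt_0_iff)
qed

corollary sum_dual_code_chr_vec:
  fixes C :: "('a::finite_field ^ 'm) set"
  assumes "vec.subspace C"
  shows "(\<Sum>d\<in>dual_code C. chr_vec d x) = (if x \<in> C then of_nat (card (dual_code C)) else 0)"
proof -
  have "card C \<noteq> 0"
    using vec.subspace_0[OF assms] by auto
  moreover have "of_nat (card C) * (\<Sum>d\<in>dual_code C. chr_vec d x) =
      of_nat (card C) * (if x \<in> C then of_nat (card (dual_code C)) else 0 :: complex)"
    using sum_chr_vec_dual_code[OF assms, of x]
    unfolding card_dual_code[OF assms, symmetric] by simp
  ultimately show ?thesis by simp
qed

section \<open>Isometries\<close>

text \<open>Only real parts of overlaps enter the estimate, so the real inner product of the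
  library, with its Cauchy-Schwarz inequality, is used throughout.\<close>

lemma Re_cinner: "Re (cinner u w) = u \<bullet> w"
  by (simp add: cinner_def inner_vec_def inner_complex_def)

lemma norm_vec_power2: "(norm u)\<^sup>2 = (\<Sum>i\<in>UNIV. (norm (u $ i))\<^sup>2)" for u :: "complex ^ 'x::finite"
  by (simp add: norm_vec_def L2_set_def sum_nonneg)

lemma sum_UNIV_prod:
  "(\<Sum>k\<in>UNIV. f k) = (\<Sum>i\<in>UNIV. \<Sum>j\<in>UNIV. f (i :: 'i::finite, j :: 'j::finite))"
  by (simp add: sum.cartesian_product)

lemma cinner_matrix_left: "cinner (A *v u) w = cinner u (adj A *v w)"
  unfolding cinner_def adj_def matrix_vector_mult_def
  by (simp add: sum_distrib_left sum_distrib_right mult_ac) (rule sum.swap)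

lemma inner_isometry:
  assumes "adj A ** A = mat 1"
  shows "(A *v u) \<bullet> (A *v w) = u \<bullet> w"
  using assms by (simp add: cinner_matrix_left matrix_vector_mul_assoc flip: Re_cinner)

text \<open>The inner product splits into slices with fixed second coordinate, and \<open>A\<close>
  acts on every slice separately.\<close>

lemma inner_tensor_op_left:
  assumes "\<And>u w. (A *v u) \<bullet> (A *v w) = u \<bullet> w"
  shows "((A \<otimes>\<^sub>m mat 1) *v s) \<bullet> ((A \<otimes>\<^sub>m mat 1) *v s') = s \<bullet> s'"
proof -
  have inner: "r \<bullet> r' = (\<Sum>j\<in>UNIV. (\<chi> k. r $ (k, j)) \<bullet> (\<chi> k. r' $ (k, j)))"
    for r r' :: "complex ^ ('i::finite \<times> 'j::finite)"
    unfolding inner_vec_def sum_UNIV_prod[of "\<lambda>k. _ $ k \<bullet> _ $ k"] by (subst sum.swap) simp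
  show ?thesis
    unfolding inner by (simp add: tensor_op_left_nth assms)
qed

lemma inner_diag_op:
  assumes "\<And>x. norm (f x) = 1"
  shows "(diag_op f *v u) \<bullet> (diag_op f *v w) = u \<bullet> w"
proof -
  have "cnj (f x) * f x = 1" for x
    using assms[of x] complex_norm_square[of "f x"] by (simp add: mult.commute)
  then have "cnj (f x * a) * (f x * b) = cnj a * b" for x a b
    by (metis complex_cnj_mult mult.assoc mult.left_commute mult_1)
  then show ?thesis
    by (simp only: cinner_def diag_op_nth flip: Re_cinner)
qed

lemma norm_tensor_vec: "norm (u \<otimes>\<^sub>v w) = norm u * norm w"
proof (rule power2_eq_imp_eq)
  show "(norm (u \<otimes>\<^sub>v w))\<^sup>2 = (norm u * norm w)\<^sup>2"
    unfolding power_mult_distrib norm_vec_power2 sum_UNIV_prod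
    by (simp add: tensor_vec_def norm_mult power_mult_distrib sum_product)
qed simp_all

lemma adj_QFT_QFT: "adj QFT ** QFT = (mat 1 :: complex ^ ('a::finite_field ^ 'm) ^ ('a ^ 'm))"
proof (subst vec_eq_iff, intro allI, subst vec_eq_iff, intro allI)
  fix x x' :: "'a ^ 'm"
  define c where "c = real CARD('a) powr (- (real CARD('m) / 2))"
  have "c * c = real CARD('a) powr (- real CARD('m))"
    by (simp add: c_def flip: powr_add)
  then have c: "c * c * real CARD('a ^ 'm) = 1"
    by (simp add: powr_minus powr_realpow)
  have "(adj QFT ** QFT) $ x $ x' =
      (\<Sum>y\<in>UNIV. of_real (c * c) * chr_vec (x' - x) (y :: 'a ^ 'm))"
    unfolding matrix_matrix_mult_def adj_def QFT_def c_def
    by (simp add: cnj_chr_vec mult_ac chr_vec_diff_left)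
  also have "\<dots> = (if x' = x then of_real (c * c * real CARD('a ^ 'm)) else 0)"
    by (simp add: sum_chr_vec_UNIV flip: sum_distrib_left del: CARD_vec)
  finally show "(adj QFT ** QFT) $ x $ x' = mat 1 $ x $ x'"
    unfolding c by (simp add: mat_def)
qed

lemma QFT_adj_QFT: "QFT ** adj QFT = (mat 1 :: complex ^ ('a::finite_field ^ 'm) ^ ('a ^ 'm))"
  using adj_QFT_QFT matrix_left_right_inverse by blast

lemma adj_adj: "adj (adj A) = A"
  by (simp add: adj_def vec_eq_iff)

section \<open>Operators and states on a register\<close>

lemma X_op_mult_left_nth: "(X_op v ** M) $ x $ y = M $ (x - v) $ y"
proof -
  have "(X_op v ** M) $ x $ y = (\<Sum>k\<in>UNIV. if k = x - v then M $ k $ y else 0)"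
    unfolding matrix_matrix_mult_def X_op_def basis_map_def vec_lambda_beta
    by (rule sum.cong) (auto simp: algebra_simps)
  then show ?thesis by simp
qed

lemma X_op_mult_right_nth: "(M ** X_op v) $ x $ y = M $ x $ (y + v)"
proof -
  have "(M ** X_op v) $ x $ y = (\<Sum>k\<in>UNIV. if k = y + v then M $ x $ k else 0)"
    unfolding matrix_matrix_mult_def X_op_def basis_map_def vec_lambda_beta
    by (rule sum.cong) auto
  then show ?thesis by simp
qed

text \<open>Conjugation by \<open>X_op v\<close> translates the diagonal, and a diagonal observable
  sees only the diagonal of the reduced state, that is, squared moduli of amplitudes.\<close>

lemma Re_trace_shifted_diagonal:
  assumes "\<And>x y. x \<noteq> y \<Longrightarrow> H $ x $ y = 0" and "\<And>x. H $ x $ x = complex_of_real (h x)"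
  shows "Re (trace (X_op v ** H ** X_op (- v) ** reduced_fst s)) =
    (\<Sum>k\<in>UNIV. h (fst k - v) * (norm (s $ k))\<^sup>2)"
proof -
  have entry: "(X_op v ** H ** X_op (- v)) $ x $ y = (if y = x then h (x - v) else 0)" for x y
    using assms by (simp add: X_op_mult_right_nth X_op_mult_left_nth)
  have "trace (X_op v ** H ** X_op (- v) ** reduced_fst s) =
      (\<Sum>x\<in>UNIV. of_real (h (x - v)) * reduced_fst s $ x $ x)"
    unfolding trace_def matrix_matrix_mult_def[of "X_op v ** H ** X_op (- v)"]
    by (simp add: entry if_distrib[of of_real] if_distrib[of "\<lambda>z. z * _"] cong: if_cong)
  also have "\<dots> = (\<Sum>x\<in>UNIV. \<Sum>y\<in>UNIV. of_real (h (x - v) * (norm (s $ (x, y)))\<^sup>2))"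
    by (simp add: reduced_fst_def sum_distrib_left flip: complex_norm_square)
  finally show ?thesis
    by (simp add: sum_UNIV_prod)
qed

lemma density_op_reduced_fst:
  assumes "norm s = 1"
  shows "density_op (reduced_fst s)"
  unfolding density_op_def
proof (intro conjI allI)
  show "adj (reduced_fst s) = reduced_fst s"
    by (simp add: adj_def reduced_fst_def vec_eq_iff mult.commute)
  have "trace (reduced_fst s) = of_real (\<Sum>k\<in>UNIV. (norm (s $ k))\<^sup>2)"
    by (simp add: trace_def reduced_fst_def sum_UNIV_prod flip: complex_norm_square)
  then show "trace (reduced_fst s) = 1"
    using assms by (simp flip: norm_vec_power2)
next
  fix u
  have "cinner u (reduced_fst s *v u) = (\<Sum>x\<in>UNIV. \<Sum>x'\<in>UNIV. \<Sum>y\<in>UNIV.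
      cnj (u $ x) * s $ (x, y) * cnj (cnj (u $ x') * s $ (x', y)))"
    by (simp add: cinner_def matrix_vector_mult_def reduced_fst_def sum_distrib_left
        sum_distrib_right mult_ac)
  \<comment> \<open>With the traced-out index \<open>y\<close> outermost, the two inner sums form a
    product \<open>z * cnj z\<close>, which gives positivity.\<close>
  also have "\<dots> = (\<Sum>y\<in>UNIV. \<Sum>x\<in>UNIV. \<Sum>x'\<in>UNIV.
      cnj (u $ x) * s $ (x, y) * cnj (cnj (u $ x') * s $ (x', y)))"
    by (subst (2) sum.swap, subst sum.swap) (rule refl)
  also have "\<dots> = of_real (\<Sum>y\<in>UNIV. (norm (\<Sum>x\<in>UNIV. cnj (u $ x) * s $ (x, y)))\<^sup>2)"
    by (simp only: of_real_sum complex_norm_square cnj_sum sum_product)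
  finally have *: "cinner u (reduced_fst s *v u) =
      of_real (\<Sum>y\<in>UNIV. (norm (\<Sum>x\<in>UNIV. cnj (u $ x) * s $ (x, y)))\<^sup>2)" .
  show "cinner u (reduced_fst s *v u) \<in> \<real>"
    unfolding * by (rule Reals_of_real)
  show "0 \<le> Re (cinner u (reduced_fst s *v u))"
    unfolding * Re_complex_of_real by (intro sum_nonneg zero_le_power2)
qed

lemma supported_on_reduced_fst:
  assumes "\<And>x y. x \<notin> A \<Longrightarrow> s $ (x, y) = 0"
  shows "supported_on (reduced_fst s) A"
  using assms unfolding supported_on_def reduced_fst_def
  by (metis (no_types, lifting) complex_cnj_zero mult_zero_left mult_zero_right sum.neutral vec_lambda_beta)

section \<open>Averaging over the shifts\<close>

lemma inner_smult_smult: "(z *s a) \<bullet> (w *s b) = Re (cnj z * w * cinner a b)"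
  by (simp add: cinner_def sum_distrib_left mult_ac flip: Re_cinner)

text \<open>Parseval in the shift: the phases of distinct \<open>d\<close> are orthogonal as
  functions of \<open>v\<close>, so only equal indices survive, whatever the vectors
  \<open>a d\<close> and \<open>b d\<close> are.\<close>

lemma sum_inner_chr_vec:
  fixes D :: "('a::finite_field ^ 'm) set" and a b :: "'a ^ 'm \<Rightarrow> complex ^ 'x::finite"
  shows "(\<Sum>v\<in>UNIV. (\<Sum>d\<in>D. chr_vec v (- d) *s a d) \<bullet> (\<Sum>d\<in>D. chr_vec v (- d) *s b d)) =
    real CARD('a ^ 'm) * (\<Sum>d\<in>D. a d \<bullet> b d)"
proof -
  have orth: "(\<Sum>v\<in>UNIV. cnj (chr_vec v (- d)) * chr_vec v (- d')) =
      (if d' = d then of_nat CARD('a ^ 'm) else 0)" for d d' :: "'a ^ 'm"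
  proof -
    have "(\<Sum>v\<in>UNIV. cnj (chr_vec v (- d)) * chr_vec v (- d')) = (\<Sum>v\<in>UNIV. chr_vec (d - d') v)"
      unfolding cnj_chr_vec minus_minus chr_vec_commute[of "d - d'"] chr_vec_diff_right by (rule refl)
    also have "\<dots> = (if d' = d then of_nat CARD('a ^ 'm) else 0)"
      unfolding sum_chr_vec_UNIV by auto
    finally show ?thesis .
  qed
  have "(\<Sum>v\<in>UNIV. (\<Sum>d\<in>D. chr_vec v (- d) *s a d) \<bullet> (\<Sum>d\<in>D. chr_vec v (- d) *s b d)) =
      (\<Sum>v\<in>UNIV. \<Sum>d\<in>D. \<Sum>d'\<in>D. Re (cnj (chr_vec v (- d)) * chr_vec v (- d') * cinner (a d) (b d')))"
    by (simp only: inner_sum_left inner_sum_right inner_smult_smult) (subst (2) sum.swap, rule refl)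
  also have "\<dots> = (\<Sum>d\<in>D. \<Sum>d'\<in>D.
      Re ((\<Sum>v\<in>UNIV. cnj (chr_vec v (- d)) * chr_vec v (- d')) * cinner (a d) (b d')))"
    by (subst sum.swap, rule sum.cong[OF refl], subst sum.swap)
      (simp only: sum_distrib_right Re_sum)
  also have "\<dots> = (\<Sum>d\<in>D. \<Sum>d'\<in>D.
      if d' = d then real CARD('a ^ 'm) * (a d \<bullet> b d') else 0)"
    unfolding orth by (intro sum.cong) (simp_all add: Re_cinner del: CARD_vec)
  also have "\<dots> = (\<Sum>d\<in>D. real CARD('a ^ 'm) * (a d \<bullet> b d))"
    by (intro sum.cong) (simp_all del: CARD_vec)
  finally show ?thesis
    by (simp only: sum_distrib_left)
qed

text \<open>Coordinatewise the difference of squares is the real inner product of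
  \<open>I - A\<close> and \<open>I + A\<close>, and weights in [0,1] only shrink absolute values.
  Keeping both norms as factors lets the overlap terms combine later to
  \<open>1 - s\<^sup>2\<close>.\<close>

lemma weighted_norm_diff_le:
  fixes I A :: "complex ^ 'x::finite"
  assumes "\<And>k. 0 \<le> h k" and "\<And>k. h k \<le> 1"
  shows "(\<Sum>k\<in>UNIV. h k * ((norm (I $ k))\<^sup>2 - (norm (A $ k))\<^sup>2)) \<le> norm (I - A) * norm (I + A)"
proof -
  have "h k * ((norm (I $ k))\<^sup>2 - (norm (A $ k))\<^sup>2) \<le> \<bar>norm ((I - A) $ k)\<bar> * \<bar>norm ((I + A) $ k)\<bar>"
    for k
  proof -
    have "(norm (I $ k))\<^sup>2 - (norm (A $ k))\<^sup>2 = (I $ k - A $ k) \<bullet> (I $ k + A $ k)"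
      by (simp add: power2_norm_eq_inner algebra_simps inner_commute)
    also have "\<bar>\<dots>\<bar> \<le> norm (I $ k - A $ k) * norm (I $ k + A $ k)"
      by (rule Cauchy_Schwarz_ineq2)
    finally have *: "\<bar>(norm (I $ k))\<^sup>2 - (norm (A $ k))\<^sup>2\<bar> \<le> norm ((I - A) $ k) * norm ((I + A) $ k)"
      by simp
    have "h k * ((norm (I $ k))\<^sup>2 - (norm (A $ k))\<^sup>2) \<le> 1 * \<bar>(norm (I $ k))\<^sup>2 - (norm (A $ k))\<^sup>2\<bar>"
      by (intro order.trans[OF mult_left_mono[OF abs_ge_self] mult_right_mono] assms abs_ge_zero)
    with * show ?thesis by simp
  qed
  then have "(\<Sum>k\<in>UNIV. h k * ((norm (I $ k))\<^sup>2 - (norm (A $ k))\<^sup>2)) \<le>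
      (\<Sum>k\<in>UNIV. \<bar>norm ((I - A) $ k)\<bar> * \<bar>norm ((I + A) $ k)\<bar>)"
    by (rule sum_mono)
  also have "\<dots> \<le> norm (I - A) * norm (I + A)"
    unfolding norm_vec_def by (rule L2_set_mult_ineq)
  finally show ?thesis .
qed

text \<open>The overlap \<open>s\<close> enters as \<open>\<parallel>I - A\<parallel>\<^sup>2 \<cdot> \<parallel>I + A\<parallel>\<^sup>2 = (2 - 2s)(2 + 2s)\<close>
  in the direct sum over \<open>v\<close>, where both families are unit vectors.\<close>

lemma average_weighted_norm_diff_le:
  fixes I A :: "'v::finite \<Rightarrow> complex ^ 'x::finite" and N :: real
  assumes h: "\<And>v k. 0 \<le> h v k" "\<And>v k. h v k \<le> 1"
    and I: "(\<Sum>v\<in>UNIV. I v \<bullet> I v) = N" and A: "(\<Sum>v\<in>UNIV. A v \<bullet> A v) = N"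
    and IA: "(\<Sum>v\<in>UNIV. I v \<bullet> A v) = N * s" and "0 \<le> N"
  shows "(\<Sum>v\<in>UNIV. \<Sum>k\<in>UNIV. h v k * ((norm (I v $ k))\<^sup>2 - (norm (A v $ k))\<^sup>2)) \<le>
    N * (2 * sqrt (1 - s\<^sup>2))"
proof -
  have minus: "(\<Sum>v\<in>UNIV. (norm (I v - A v))\<^sup>2) = N * (2 - 2 * s)"
    using I A IA by (simp add: power2_norm_eq_inner inner_diff inner_commute[of "A v" "I v" for v]
        sum.distrib sum_subtractf algebra_simps flip: sum_distrib_left)
  have plus: "(\<Sum>v\<in>UNIV. (norm (I v + A v))\<^sup>2) = N * (2 + 2 * s)"
    using I A IA by (simp add: power2_norm_eq_inner inner_add inner_commute[of "A v" "I v" for v]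
        sum.distrib algebra_simps flip: sum_distrib_left)
  have "(\<Sum>v\<in>UNIV. \<Sum>k\<in>UNIV. h v k * ((norm (I v $ k))\<^sup>2 - (norm (A v $ k))\<^sup>2)) \<le>
      (\<Sum>v\<in>UNIV. \<bar>norm (I v - A v)\<bar> * \<bar>norm (I v + A v)\<bar>)"
    unfolding abs_norm_cancel by (intro sum_mono weighted_norm_diff_le h)
  \<comment> \<open>A second Cauchy-Schwarz, now over \<open>v\<close>: only the sums over
    \<open>v\<close> of the squared norms are known.\<close>
  also have "\<dots> \<le> sqrt (N * (2 - 2 * s)) * sqrt (N * (2 + 2 * s))"
    using L2_set_mult_ineq[of "\<lambda>v. norm (I v - A v)" "\<lambda>v. norm (I v + A v)" UNIV]
    by (simp add: L2_set_def minus plus)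
  also have "\<dots> = sqrt ((2 * N)\<^sup>2 * (1 - s\<^sup>2))"
    by (simp add: power2_eq_square algebra_simps flip: real_sqrt_mult)
  also have "\<dots> = N * (2 * sqrt (1 - s\<^sup>2))"
    using \<open>0 \<le> N\<close> by (simp add: real_sqrt_mult)
  finally show ?thesis .
qed

section \<open>The state produced by the reduction\<close>

lemma norm_qdp_state: "norm (qdp_state Q d) = norm Q"
proof -
  have "(\<Sum>y\<in>UNIV. (norm (Q $ (y - d)))\<^sup>2) = (\<Sum>y\<in>UNIV. (norm (Q $ y))\<^sup>2)"
    by (rule sum.reindex_bij_witness[of _ "\<lambda>y. y + d" "\<lambda>y. y - d"]) auto
  then show ?thesis
    by (simp add: norm_vec_def L2_set_def qdp_state_nth)
qed

text \<open>The failed branch \<open>\<delta>\<close> vanishes where the last register is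
  \<open>d\<close>, the only place where \<open>b\<close> lives; hence both inner products are the
  success probability.\<close>

lemma qdp_decomposition_inner:
  assumes "qdp_decomposition U anc Q d \<epsilon> \<xi> \<delta>"
  defines "b \<equiv> sqrt (1 - \<epsilon>) *\<^sub>R (\<xi> \<otimes>\<^sub>v ket d)"
  shows "b \<bullet> b = 1 - \<epsilon>" and "(U *v (qdp_state Q d \<otimes>\<^sub>v anc)) \<bullet> b = 1 - \<epsilon>"
proof -
  have "(\<xi> \<otimes>\<^sub>v ket d) \<bullet> (\<xi> \<otimes>\<^sub>v ket d) = 1"
    using assms by (simp add: qdp_decomposition_def norm_tensor_vec flip: power2_norm_eq_inner)
  then show b: "b \<bullet> b = 1 - \<epsilon>"
    using assms by (simp add: qdp_decomposition_def)
  have "\<delta> $ k \<bullet> (\<xi> \<otimes>\<^sub>v ket d) $ k = 0" for k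
    using assms by (cases k) (auto simp: qdp_decomposition_def tensor_vec_def axis_def)
  then have "\<delta> \<bullet> b = 0"
    by (simp add: b_def inner_vec_def)
  moreover have "U *v (qdp_state Q d \<otimes>\<^sub>v anc) = b + sqrt \<epsilon> *\<^sub>R \<delta>"
    using assms by (simp add: qdp_decomposition_def)
  ultimately show "(U *v (qdp_state Q d \<otimes>\<^sub>v anc)) \<bullet> b = 1 - \<epsilon>"
    using b by (simp add: inner_add_left)
qed

lemma matrix_vector_mult_sum_smult:
  "A *v (\<Sum>d\<in>D. c d *s f d) = (\<Sum>d\<in>D. c d *s (A *v f d))" for A :: "complex ^ 'x ^ 'y"
  by (simp add: vec_eq_iff matrix_vector_mult_def sum_distrib_left mult_ac) (rule allI, rule sum.swap)

text \<open>A decoder with its decompositions fixed. \<open>success_pos\<close> says that the error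
  averaged over the dual code is below 1, so that postselection leaves a nonzero vector to
  normalize.\<close>

locale decoder =
  fixes U :: "complex ^ (('a::finite_field ^ 'm) \<times> 'n::finite) ^ ('g::finite \<times> ('a ^ 'm))"
    and anc :: "complex ^ 'n"
    and P :: "complex ^ ('a ^ 'm)"
    and C :: "('a ^ 'm) set"
    and err :: "'a ^ 'm \<Rightarrow> real"
    and \<xi> :: "'a ^ 'm \<Rightarrow> complex ^ 'g"
    and \<delta> :: "'a ^ 'm \<Rightarrow> complex ^ ('g \<times> ('a ^ 'm))"
  assumes unitary: "unitary_op U"
    and norm_anc: "norm anc = 1"
    and norm_P: "norm P = 1"
    and subspace: "vec.subspace C"
    and decomposition: "\<And>d. d \<in> dual_code C \<Longrightarrow>
      qdp_decomposition U anc (QFT *v P) d (err d) (\<xi> d) (\<delta> d)"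
    and success_pos: "0 < (\<Sum>d\<in>dual_code C. 1 - err d)"
begin

abbreviation "D \<equiv> dual_code C"

definition decode_out :: "'a ^ 'm \<Rightarrow> complex ^ ('g \<times> ('a ^ 'm))" where
  "decode_out d = U *v (qdp_state (QFT *v P) d \<otimes>\<^sub>v anc)"

definition success_part :: "'a ^ 'm \<Rightarrow> complex ^ ('g \<times> ('a ^ 'm))" where
  "success_part d = sqrt (1 - err d) *\<^sub>R (\<xi> d \<otimes>\<^sub>v ket d)"

definition twist :: "('a ^ 'm \<Rightarrow> complex ^ ('g \<times> ('a ^ 'm))) \<Rightarrow> 'a ^ 'm \<Rightarrow> complex ^ ('g \<times> ('a ^ 'm))" where
  "twist f v = (\<Sum>d\<in>D. chr_vec v (- d) *s f d)"

text \<open>All steps between postselection and the conditioning on \<open>C\<close>. They are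
  isometries, so inner products can be computed at the decoder's output.\<close>

definition undo :: "'a ^ 'm \<Rightarrow> complex ^ ('g \<times> ('a ^ 'm)) \<Rightarrow> complex ^ (('a ^ 'm) \<times> 'n)" where
  "undo v s = (adj QFT \<otimes>\<^sub>m mat 1) *v ((Z_op v \<otimes>\<^sub>m mat 1) *v (adj U *v s))"

text \<open>The prefactor makes the norm 1 only on average over \<open>v\<close>; for a single
  \<open>v\<close> it depends on the weight of \<open>P\<close> on the translate of \<open>C\<close>
  by \<open>- v\<close>.\<close>

definition ideal :: "'a ^ 'm \<Rightarrow> complex ^ (('a ^ 'm) \<times> 'n)" where
  "ideal v = (1 / sqrt (card D)) *\<^sub>R undo v (twist decode_out v)"

definition actual :: "'a ^ 'm \<Rightarrow> complex ^ (('a ^ 'm) \<times> 'n)" where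
  "actual v = (adj QFT \<otimes>\<^sub>m mat 1) *v regev_actual U anc (QFT *v P) D v"

section \<open>Norms and overlaps of the ideal and the actual state\<close>

lemma inner_undo: "undo v s \<bullet> undo v s' = s \<bullet> s'"
proof -
  have U: "adj (adj U) ** adj U = mat 1"
    using unitary by (simp add: unitary_op_def adj_adj)
  have Q: "adj (adj QFT) ** adj QFT = (mat 1 :: complex ^ ('a ^ 'm) ^ ('a ^ 'm))"
    by (simp add: adj_adj QFT_adj_QFT)
  show ?thesis
    unfolding undo_def
    by (simp only: inner_tensor_op_left[OF inner_isometry[OF Q]] inner_isometry[OF U]
        inner_tensor_op_left[OF inner_diag_op[OF norm_chr_vec]] Z_op_def)
qed

lemma inner_decode_out: "decode_out d \<bullet> decode_out d = 1"
proof -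
  have "(QFT *v P) \<bullet> (QFT *v P) = P \<bullet> P"
    by (rule inner_isometry[OF adj_QFT_QFT])
  then have "norm (QFT *v P) = 1"
    using norm_P by (simp add: norm_eq_sqrt_inner)
  moreover have "decode_out d \<bullet> decode_out d =
      (qdp_state (QFT *v P) d \<otimes>\<^sub>v anc) \<bullet> (qdp_state (QFT *v P) d \<otimes>\<^sub>v anc)"
    unfolding decode_out_def using unitary by (intro inner_isometry) (simp add: unitary_op_def)
  ultimately show ?thesis
    using norm_anc by (simp add: norm_tensor_vec norm_qdp_state flip: power2_norm_eq_inner)
qed

lemma inner_success_part:
  assumes "d \<in> D"
  shows "success_part d \<bullet> success_part d = 1 - err d" "decode_out d \<bullet> success_part d = 1 - err d"
  using qdp_decomposition_inner[OF decomposition[OF assms]]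
  by (simp_all only: success_part_def decode_out_def)

lemma decode_out_nth:
  assumes "d \<in> D"
  shows "decode_out d $ (g, d) = sqrt (1 - err d) * \<xi> d $ g"
  using decomposition[OF assms]
  by (simp add: qdp_decomposition_def decode_out_def tensor_vec_def
      scaleR_conv_of_real[where 'a = complex])

text \<open>Distinct dual codewords occupy distinct values of the last register, so one term
  remains; there the failed branch is 0 and the full decoder output equals its successful
  part.\<close>

lemma twist_success_part_nth:
  "twist success_part v $ (g, y) =
    (if y \<in> D then chr_vec v (- y) * decode_out y $ (g, y) else 0)"
proof -
  have "twist success_part v $ (g, y) =
      (\<Sum>d\<in>D. if d = y then chr_vec v (- y) * (sqrt (1 - err y) * \<xi> y $ g) else 0)"
    unfolding twist_def sum_component
    by (intro sum.cong)
      (auto simp: success_part_def tensor_vec_def axis_def scaleR_conv_of_real[where 'a = complex])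
  then show ?thesis by (simp add: decode_out_nth)
qed

text \<open>Phases of modulus 1 on orthogonal blocks do not affect the norm, so the postselection
  probability is the same for every \<open>v\<close>.\<close>

lemma inner_twist_success_part:
  "twist success_part v \<bullet> twist success_part v = (\<Sum>d\<in>D. 1 - err d)"
proof -
  have "(norm (twist success_part v))\<^sup>2 =
      (\<Sum>y\<in>UNIV. \<Sum>g\<in>UNIV. (norm (twist success_part v $ (g, y)))\<^sup>2)"
    unfolding norm_vec_power2 sum_UNIV_prod by (rule sum.swap)
  also have "\<dots> = (\<Sum>y\<in>UNIV. if y \<in> D then 1 - err y else 0)"
  proof (rule sum.cong[OF refl])
    fix y :: "'a ^ 'm"
    show "(\<Sum>g\<in>UNIV. (norm (twist success_part v $ (g, y)))\<^sup>2) = (if y \<in> D then 1 - err y else 0)"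
    proof (cases "y \<in> D")
      case True
      have "(\<Sum>g\<in>UNIV. (norm (twist success_part v $ (g, y)))\<^sup>2) =
          (sqrt (1 - err y))\<^sup>2 * (\<Sum>g\<in>UNIV. (norm (\<xi> y $ g))\<^sup>2)"
        using True
        by (simp add: twist_success_part_nth decode_out_nth norm_mult norm_chr_vec power_mult_distrib sum_distrib_left)
      then show ?thesis
        using decomposition[OF True] True by (simp add: qdp_decomposition_def flip: norm_vec_power2)
    qed (simp add: twist_success_part_nth)
  qed
  also have "\<dots> = (\<Sum>d\<in>D. 1 - err d)"
    by (simp add: sum.If_cases)
  finally show ?thesis
    by (simp add: power2_norm_eq_inner)
qed

lemma actual_eq: "actual v = (1 / sqrt (\<Sum>d\<in>D. 1 - err d)) *\<^sub>R undo v (twist success_part v)"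
proof -
  let ?t = "basis_proj {(d, g, y). y = d} *v regev_decoded U anc (QFT *v P) D v"
  \<comment> \<open>Postselection keeps the amplitudes with equal first and last register; in
    modulus these are the ones of \<open>twist success_part v\<close>, up to the normalization of
    the sum over \<open>D\<close>.\<close>
  have "(norm ?t)\<^sup>2 = (\<Sum>d\<in>UNIV. \<Sum>g\<in>UNIV. \<Sum>y\<in>UNIV.
      if y = d then (norm (twist success_part v $ (g, d)))\<^sup>2 / card D else 0)"
    unfolding norm_vec_power2 sum_UNIV_prod
    by (intro sum.cong refl)
      (simp add: basis_proj_def diag_op_nth regev_decoded_nth twist_success_part_nth decode_out_def
        norm_mult norm_divide power_divide power_mult_distrib)
  also have "\<dots> = (\<Sum>d\<in>UNIV. \<Sum>g\<in>UNIV. (norm (twist success_part v $ (g, d)))\<^sup>2) / card D"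
    by (simp add: sum_divide_distrib)
  also have "\<dots> = (\<Sum>d\<in>D. 1 - err d) / card D"
    unfolding inner_twist_success_part[symmetric, of v] power2_norm_eq_inner[symmetric]
      norm_vec_power2[of "twist _ _"] sum_UNIV_prod
    by (subst sum.swap) (rule refl)
  finally have "norm ?t = sqrt ((\<Sum>d\<in>D. 1 - err d) / card D)"
    by (metis norm_ge_zero real_sqrt_abs abs_of_nonneg)
  then have coeff: "norm ?t * sqrt (card D) = sqrt (\<Sum>d\<in>D. 1 - err d)"
    using card_dual_code_pos[of C] by (simp add: real_sqrt_divide)
  have "(\<Sum>d\<in>D. (chr_vec v (- d) * complex_of_real (sqrt (1 - err d))) *s (\<xi> d \<otimes>\<^sub>v ket d)) =
      twist success_part v"
    unfolding twist_def success_part_def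
    by (intro sum.cong) (simp_all add: vec_eq_iff scaleR_conv_of_real[where 'a = complex])
  then show ?thesis
    using regev_actual_closed_form[of D U anc "QFT *v P" err \<xi> \<delta> v] decomposition
    unfolding actual_def undo_def coeff
    by (simp add: matrix_vector_mult_scaleR_complex)
qed

lemma inner_actual: "actual v \<bullet> actual v = 1"
  using success_pos
  by (simp add: actual_eq inner_undo inner_twist_success_part flip: power2_eq_square)

lemma sum_inner_ideal: "(\<Sum>v\<in>UNIV. ideal v \<bullet> ideal v) = CARD('a ^ 'm)"
proof -
  have "(\<Sum>v\<in>UNIV. ideal v \<bullet> ideal v) =
      (\<Sum>v\<in>UNIV. twist decode_out v \<bullet> twist decode_out v) / card D"
    by (simp add: ideal_def inner_undo sum_divide_distrib flip: power2_eq_square)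
  then show ?thesis
    using card_dual_code_pos[of C]
    unfolding twist_def sum_inner_chr_vec by (auto simp: card_gt_0_iff inner_decode_out del: CARD_vec)
qed

text \<open>Decoder output and successful part overlap exactly in the success probability; dividing
  by the norm of the successful part leaves a square root.\<close>

lemma sum_inner_ideal_actual:
  "(\<Sum>v\<in>UNIV. ideal v \<bullet> actual v) = CARD('a ^ 'm) * sqrt ((\<Sum>d\<in>D. 1 - err d) / card D)"
proof -
  have "(\<Sum>v\<in>UNIV. ideal v \<bullet> actual v) =
      (\<Sum>v\<in>UNIV. twist decode_out v \<bullet> twist success_part v) / (sqrt (card D) * sqrt (\<Sum>d\<in>D. 1 - err d))"
    by (simp add: ideal_def actual_eq inner_undo sum_divide_distrib mult.commute)
  also have "\<dots> = CARD('a ^ 'm) * ((\<Sum>d\<in>D. 1 - err d) / sqrt (\<Sum>d\<in>D. 1 - err d) / sqrt (card D))"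
    unfolding twist_def sum_inner_chr_vec by (simp add: inner_success_part del: CARD_vec)
  also have "(\<Sum>d\<in>D. 1 - err d) / sqrt (\<Sum>d\<in>D. 1 - err d) = sqrt (\<Sum>d\<in>D. 1 - err d)"
    using success_pos by (simp add: real_div_sqrt)
  finally show ?thesis
    by (simp add: real_sqrt_divide)
qed

text \<open>Undoing the decoder returns the noisy dual codewords. The inverse Fourier transform
  turns the shift by \<open>d\<close> into a phase, \<open>Z_op v\<close> translates
  \<open>P\<close>, and the remaining phases sum to a multiple of the indicator of
  \<open>C\<close>.\<close>

lemma ideal_nth:
  "ideal v $ (x, n) = (if x \<in> C then sqrt (card D) * P $ (x - v) * anc $ n else 0)"
proof -
  define Q where "Q = QFT *v P"
  define c :: complex where "c = of_real (real CARD('a) powr (- (real CARD('m) / 2)))"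
  have inv: "(\<Sum>k\<in>UNIV. c * chr_vec (- y) k * Q $ k) = P $ y" for y
  proof -
    have "adj QFT *v Q = P"
      unfolding Q_def matrix_vector_mul_assoc adj_QFT_QFT by simp
    then have "(adj QFT *v Q) $ y = P $ y" by simp
    then show ?thesis
      by (simp add: matrix_vector_mult_def adj_def QFT_def c_def cnj_chr_vec chr_vec_uminus
          chr_vec_commute[of _ y])
  qed
  have "adj U *v twist decode_out v = (\<Sum>d\<in>D. chr_vec v (- d) *s (qdp_state Q d \<otimes>\<^sub>v anc))"
    using unitary unfolding twist_def decode_out_def unitary_op_def
    by (simp add: matrix_vector_mult_sum_smult matrix_vector_mul_assoc Q_def)
  then have "undo v (twist decode_out v) $ (x, n) = (\<Sum>k\<in>UNIV. c * chr_vec (- x) k *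
      (chr_vec v k * (\<Sum>d\<in>D. chr_vec v (- d) * (Q $ (k - d) * anc $ n))))"
    unfolding undo_def tensor_op_left_nth matrix_vector_mult_def[of "adj QFT"]
    by (simp add: tensor_op_left_nth Z_op_def diag_op_nth adj_def QFT_def c_def cnj_chr_vec chr_vec_uminus chr_vec_commute[of _ x]
        tensor_vec_def qdp_state_nth)
  also have "\<dots> = (\<Sum>d\<in>D. chr_vec v (- d) * anc $ n *
      (\<Sum>k\<in>UNIV. c * chr_vec (- (x - v)) k * Q $ (k - d)))"
    unfolding sum_distrib_left by (subst sum.swap) (simp add: mult_ac chr_vec_diff_left chr_vec_uminus)
  also have "\<dots> = (\<Sum>d\<in>D. chr_vec v (- d) * anc $ n * (chr_vec (v - x) d * P $ (x - v)))"
  proof (intro sum.cong refl arg_cong2[where f = "(*)"])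
    fix d
    have "(\<Sum>k\<in>UNIV. c * chr_vec (- (x - v)) k * Q $ (k - d)) =
        (\<Sum>k\<in>UNIV. c * chr_vec (- (x - v)) (k + d) * Q $ k)"
      by (rule sum.reindex_bij_witness[of _ "\<lambda>k. k + d" "\<lambda>k. k - d"]) auto
    also have "\<dots> = chr_vec (v - x) d * (\<Sum>k\<in>UNIV. c * chr_vec (- (x - v)) k * Q $ k)"
      by (simp add: chr_vec_add_right sum_distrib_left mult_ac)
    finally show "(\<Sum>k\<in>UNIV. c * chr_vec (- (x - v)) k * Q $ (k - d)) = chr_vec (v - x) d * P $ (x - v)"
      unfolding inv .
  qed
  also have "\<dots> = P $ (x - v) * anc $ n * (\<Sum>d\<in>D. chr_vec d (- x))"
  proof -
    \<comment> \<open>The phase from \<open>Z_op (- v)\<close> cancels the one that the translation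
      by \<open>v\<close> produces, leaving a character of \<open>d\<close> that is free of
      \<open>v\<close>.\<close>
    have "chr_vec v (- d) * chr_vec (v - x) d = chr_vec d (- x)" for d
    proof -
      have "chr_vec v (- d) * chr_vec v d = 1"
        by (simp add: chr_vec_0_right flip: chr_vec_add_right)
      then show ?thesis
        by (simp add: chr_vec_diff_left chr_vec_commute[of d] chr_vec_uminus mult.assoc[symmetric])
    qed
    then show ?thesis
      by (simp add: sum_distrib_left mult_ac) (metis mult.assoc)
  qed
  also have "(\<Sum>d\<in>D. chr_vec d (- x)) = (if x \<in> C then of_nat (card D) else 0)"
    using sum_dual_code_chr_vec[OF subspace, of "- x"] vec.subspace_neg[OF subspace]
    by (metis minus_minus)
  finally have "undo v (twist decode_out v) $ (x, n) =
      (if x \<in> C then of_real (card D) * P $ (x - v) * anc $ n else 0)"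
    by simp
  moreover have "complex_of_real (card D) = of_real (sqrt (card D)) * of_real (sqrt (card D))"
    by (simp flip: of_real_mult)
  moreover have "sqrt (card D) \<noteq> 0"
    using card_dual_code_pos[of C] by (auto simp: card_gt_0_iff)
  ultimately show ?thesis
    by (simp add: ideal_def scaleR_conv_of_real[where 'a = complex])
qed

text \<open>Objective and amplitudes are translated by the same \<open>v\<close>, so for each
  codeword \<open>x\<close> the point \<open>x - v\<close> runs once through the whole space;
  \<open>card C * card D\<close> is the size of the space.\<close>

lemma sum_ideal:
  fixes h :: "'a ^ 'm \<Rightarrow> real"
  shows "(\<Sum>v\<in>UNIV. \<Sum>k\<in>UNIV. h (fst k - v) * (norm (ideal v $ k))\<^sup>2) =
    CARD('a ^ 'm) * (\<Sum>x\<in>UNIV. h x * (norm (P $ x))\<^sup>2)"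
proof -
  have anc: "(\<Sum>n\<in>UNIV. (norm (anc $ n))\<^sup>2) = 1"
    using norm_anc by (simp flip: norm_vec_power2)
  have "(\<Sum>n\<in>UNIV. h (x - v) * (norm (ideal v $ (x, n)))\<^sup>2) =
      (if x \<in> C then card D * (h (x - v) * (norm (P $ (x - v)))\<^sup>2) else 0)" for v x
  proof -
    have "(\<Sum>n\<in>UNIV. h (x - v) * (norm (ideal v $ (x, n)))\<^sup>2) =
        (if x \<in> C then card D * (h (x - v) * (norm (P $ (x - v)))\<^sup>2) else 0) *
          (\<Sum>n\<in>UNIV. (norm (anc $ n))\<^sup>2)"
      unfolding sum_distrib_left
      by (rule sum.cong) (auto simp: ideal_nth norm_mult power_mult_distrib)
    then show ?thesis unfolding anc by simp
  qed
  then have "(\<Sum>v\<in>UNIV. \<Sum>k\<in>UNIV. h (fst k - v) * (norm (ideal v $ k))\<^sup>2) =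
      (\<Sum>v\<in>UNIV. \<Sum>x\<in>C. card D * (h (x - v) * (norm (P $ (x - v)))\<^sup>2))"
    unfolding sum_UNIV_prod by (simp add: sum.If_cases)
  also have "\<dots> = card D * (\<Sum>x\<in>C. \<Sum>v\<in>UNIV. h (x - v) * (norm (P $ (x - v)))\<^sup>2)"
    by (subst sum.swap) (simp add: sum_distrib_left)
  also have "\<dots> = card D * (\<Sum>x\<in>C. \<Sum>v\<in>UNIV. h v * (norm (P $ v))\<^sup>2)"
    by (intro arg_cong2[where f = "(*)"] sum.cong refl
        sum.reindex_bij_witness[of _ "\<lambda>v. _ - v" "\<lambda>v. _ - v"]) auto
  finally show ?thesis
    using card_dual_code[OF subspace] by (simp add: mult_ac flip: of_nat_mult del: CARD_vec)
qed

end

section \<open>The lower bound for the averaged objective\<close>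

theorem theorem1:
  fixes H :: "complex ^ ('a::finite_field ^ 'm) ^ ('a ^ 'm)"
    and P :: "complex ^ ('a ^ 'm)"
    and C :: "('a ^ 'm) set"
    and U :: "complex ^ (('a ^ 'm) \<times> 'n::finite) ^ ('g::finite \<times> ('a ^ 'm))"
    and anc :: "complex ^ 'n"
    and \<epsilon>d :: "'a ^ 'm \<Rightarrow> real"
    and \<xi> :: "'a ^ 'm \<Rightarrow> complex ^ 'g"
    and \<delta> :: "'a ^ 'm \<Rightarrow> complex ^ ('g \<times> ('a ^ 'm))"
    and \<epsilon> :: real
    and fb :: "'a ^ 'm \<Rightarrow> complex ^ (('a ^ 'm) \<times> 'n)"
  assumes H_diagonal: "\<And>x y. x \<noteq> y \<Longrightarrow> H $ x $ y = 0"
    and H_entries: "\<And>x. H $ x $ x \<in> complex_of_real ` {0..1}"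
    and P_normalized: "norm P = 1"
    and C_linear: "vec.subspace C"
    and U_unitary: "unitary_op U"
    and anc_unit: "norm anc = 1"
    and decoder: "\<And>d. d \<in> dual_code C \<Longrightarrow>
                    qdp_decomposition U anc (QFT *v P) d (\<epsilon>d d) (\<xi> d) (\<delta> d)"
    and \<epsilon>_def: "\<epsilon> = (\<Sum>d\<in>dual_code C. \<epsilon>d d) / real (card (dual_code C))"
    and \<epsilon>_less: "\<epsilon> < 1"
    and fb_unit: "\<And>v. norm (fb v) = 1"
    and fb_range: "\<And>v. fb v \<in> range ((*v) (basis_proj C \<otimes>\<^sub>m mat 1))"
  shows "(\<forall>v. density_op (regev_output U anc (QFT *v P) C (fb v) v) \<and>
              supported_on (regev_output U anc (QFT *v P) C (fb v) v) C) \<and>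
         (\<Sum>v\<in>UNIV. Re (trace (X_op v ** H ** X_op (- v) **
                              regev_output U anc (QFT *v P) C (fb v) v))) / real CARD('a ^ 'm)
           \<ge> Re (cinner P (H *v P)) - 2 * sqrt \<epsilon>"
proof -
  let ?D = "dual_code C" and ?N = "real CARD('a ^ 'm)"
  have card_D: "real (card ?D) > 0"
    using card_dual_code_pos by simp
  have success: "(\<Sum>d\<in>?D. 1 - \<epsilon>d d) = card ?D * (1 - \<epsilon>)"
    using card_D by (auto simp: \<epsilon>_def sum_subtractf right_diff_distrib)
  interpret decoder U anc P C \<epsilon>d \<xi> \<delta>
    by standard (use assms card_D in \<open>auto simp: success\<close>)

  define h where "h x = Re (H $ x $ x)" for x
  have h: "0 \<le> h x" "h x \<le> 1" and H_h: "H $ x $ x = complex_of_real (h x)" for x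
    using H_entries[of x] by (auto simp: h_def)
  define \<psi> where "\<psi> v = regev_final U anc (QFT *v P) C (fb v) v" for v
  \<comment> \<open>\<open>w v\<close> is the state conditioned on \<open>C\<close> before
    normalization; it is compared with \<open>ideal v\<close>, and the bound is carried over to
    \<open>\<psi> v\<close> at the end.\<close>
  define w where "w v = (basis_proj C \<otimes>\<^sub>m mat 1) *v actual v" for v
  have w_nth: "w v $ k = (if fst k \<in> C then actual v $ k else 0)" for v k
    by (cases k) (simp add: w_def tensor_op_left_nth basis_proj_def diag_op_nth)
  have \<psi>_eq: "\<psi> v = (if w v = 0 then fb v else sgn (w v))" for v
  proof -
    have "((basis_proj C ** adj QFT) \<otimes>\<^sub>m mat 1) *v s =
        (basis_proj C \<otimes>\<^sub>m mat 1) *v ((adj QFT \<otimes>\<^sub>m mat 1) *v s)"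
      for s :: "complex ^ (('a ^ 'm) \<times> 'n)"
    proof (subst vec_eq_iff, rule allI)
      fix k :: "('a ^ 'm) \<times> 'n"
      show "(((basis_proj C ** adj QFT) \<otimes>\<^sub>m mat 1) *v s) $ k =
          ((basis_proj C \<otimes>\<^sub>m mat 1) *v ((adj QFT \<otimes>\<^sub>m mat 1) *v s)) $ k"
        by (cases k) (simp add: tensor_op_left_nth matrix_vector_mul_assoc[symmetric])
    qed
    then show ?thesis
      by (simp add: \<psi>_def regev_final_def Let_def w_def actual_def)
  qed
  have norm_\<psi>: "norm (\<psi> v) = 1" for v
    by (simp add: \<psi>_eq fb_unit norm_sgn)
  have supp: "\<psi> v $ (x, n) = 0" if "x \<notin> C" for v x n
  proof -
    obtain z where "fb v = (basis_proj C \<otimes>\<^sub>m mat 1) *v z"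
      using fb_range[of v] by auto
    then show ?thesis
      using that by (simp add: \<psi>_eq sgn_vec_def sgn_div_norm w_nth tensor_op_left_nth basis_proj_def diag_op_nth)
  qed
  \<comment> \<open>A projection of a unit vector has norm at most 1, so normalizing only enlarges
    amplitudes; in the fallback case the left side is 0.\<close>
  have w_le: "(norm (w v $ k))\<^sup>2 \<le> (norm (\<psi> v $ k))\<^sup>2" for v k
  proof (cases "w v = 0")
    case False
    have "(norm (w v))\<^sup>2 \<le> (norm (actual v))\<^sup>2"
      unfolding norm_vec_power2 by (intro sum_mono) (simp add: w_nth)
    also have "\<dots> = 1"
      by (simp add: power2_norm_eq_inner inner_actual)
    finally have "norm (w v) \<le> 1"
      by (simp add: power_le_one_iff)
    then have "norm (w v $ k) \<le> norm (w v $ k) / norm (w v)"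
      using False by (simp add: pos_le_divide_eq mult_left_le)
    then show ?thesis
      using False by (intro power_mono) (simp_all add: \<psi>_eq sgn_div_norm divide_inverse mult.commute)
  qed simp

  have average: "Re (cinner P (H *v P)) - 2 * sqrt \<epsilon> \<le>
      (\<Sum>v\<in>UNIV. \<Sum>k\<in>UNIV. h (fst k - v) * (norm (\<psi> v $ k))\<^sup>2) / ?N"
  proof -
    have HP: "Re (cinner P (H *v P)) = (\<Sum>x\<in>UNIV. h x * (norm (P $ x))\<^sup>2)"
    proof -
      have "H = diag_op (\<lambda>x. of_real (h x))"
        using H_diagonal H_h by (intro vec_eq_iff[THEN iffD2] allI) (auto simp: diag_op_def)
      then have "cinner P (H *v P) = of_real (\<Sum>x\<in>UNIV. h x * (norm (P $ x))\<^sup>2)"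
        by (simp only: cinner_def diag_op_nth of_real_sum of_real_mult complex_norm_square mult_ac)
      then show ?thesis by simp
    qed
    have overlap: "(\<Sum>v\<in>UNIV. ideal v \<bullet> actual v) = ?N * sqrt (1 - \<epsilon>)"
      using card_D unfolding sum_inner_ideal_actual success by (auto simp: card_gt_0_iff)
    \<comment> \<open>The weight is cut off outside \<open>C\<close>: this turns
      \<open>actual v\<close> into \<open>w v\<close> and costs \<open>ideal v\<close> nothing, as
      it already vanishes there.\<close>
    have "(\<Sum>v\<in>UNIV. \<Sum>k\<in>UNIV. (if fst k \<in> C then h (fst k - v) else 0) *
        ((norm (ideal v $ k))\<^sup>2 - (norm (actual v $ k))\<^sup>2)) \<le> ?N * (2 * sqrt (1 - (sqrt (1 - \<epsilon>))\<^sup>2))"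
      by (intro average_weighted_norm_diff_le sum_inner_ideal overlap)
        (simp_all add: h inner_actual)
    also have "1 - (sqrt (1 - \<epsilon>))\<^sup>2 = \<epsilon>"
      using \<epsilon>_less by simp
    also have "(\<Sum>v\<in>UNIV. \<Sum>k\<in>UNIV. (if fst k \<in> C then h (fst k - v) else 0) *
        ((norm (ideal v $ k))\<^sup>2 - (norm (actual v $ k))\<^sup>2)) =
        (\<Sum>v\<in>UNIV. \<Sum>k\<in>UNIV. h (fst k - v) * (norm (ideal v $ k))\<^sup>2) -
        (\<Sum>v\<in>UNIV. \<Sum>k\<in>UNIV. h (fst k - v) * (norm (w v $ k))\<^sup>2)"
      unfolding sum_subtractf[symmetric]
      by (intro sum.cong refl) (auto simp: w_nth ideal_nth right_diff_distrib)
    finally have "?N * (\<Sum>x\<in>UNIV. h x * (norm (P $ x))\<^sup>2) - ?N * (2 * sqrt \<epsilon>) \<le>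
        (\<Sum>v\<in>UNIV. \<Sum>k\<in>UNIV. h (fst k - v) * (norm (w v $ k))\<^sup>2)"
      unfolding sum_ideal by simp
    also have "\<dots> \<le> (\<Sum>v\<in>UNIV. \<Sum>k\<in>UNIV. h (fst k - v) * (norm (\<psi> v $ k))\<^sup>2)"
      by (intro sum_mono mult_left_mono w_le h)
    finally show ?thesis
      unfolding HP right_diff_distrib[symmetric] by (simp add: pos_le_divide_eq mult.commute del: CARD_vec)
  qed
  have "Re (trace (X_op v ** H ** X_op (- v) ** regev_output U anc (QFT *v P) C (fb v) v)) =
      (\<Sum>k\<in>UNIV. h (fst k - v) * (norm (\<psi> v $ k))\<^sup>2)" for v
    unfolding regev_output_def \<psi>_def[symmetric]
    using H_diagonal H_h by (rule Re_trace_shifted_diagonal)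
  with average have "Re (cinner P (H *v P)) - 2 * sqrt \<epsilon> \<le>
      (\<Sum>v\<in>UNIV. Re (trace (X_op v ** H ** X_op (- v) **
        regev_output U anc (QFT *v P) C (fb v) v))) / ?N"
    by (simp only:)
  moreover have "density_op (regev_output U anc (QFT *v P) C (fb v) v)"
    and "supported_on (regev_output U anc (QFT *v P) C (fb v) v) C" for v
    unfolding regev_output_def \<psi>_def[symmetric]
    by (intro density_op_reduced_fst norm_\<psi> supported_on_reduced_fst supp; assumption)+
  ultimately show ?thesis
    by blast
qed

end
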